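(* Every Coxeter group whose Coxeter graph is complete (that is, with $m(i,i')\ge 3$, possibly $\infty$, for all distinct $i,i'\in I$) is futuristic.
   Context: Let $(W,S)$ be a Coxeter system with $S=\{s_i:i\in I\}$, $I$ a finite index set; $m(i,i')$ is the order of $s_is_{i'}$. The Coxeter graph has vertex set $I$, with distinct $i,i'$ joined by an edge labeled $m(i,i')$ whenever $m(i,i')\ge 3$. The root space is $V=\mathbb R^I$ with standard basis the simple roots $\{\alpha_i:i\in I\}$ and symmetric bilinear form $B(\alpha_i,\alpha_{i'})=-\cos(\pi/m(i,i'))$ (and $-1$ if $m(i,i')=\infty$). $W$ acts on $V$ by $s_i\beta=\beta-2B(\beta,\alpha_i)\alpha_i$. The root system is $\Phi=\{w\alpha_i:w\in W,i\in I\}=\Phi^+\sqcup\Phi^-$, where $\Phi^+$ are the roots that are nonnegative combinations of simple roots and $\Phi^-=-\Phi^+$. For $\beta\in\Phi$ the half-space $H_\beta^+$ is $\{w\in W:w\beta\in\Phi^+\}$. A subset of $W$ is convex if it is an intersection of half-spaces (the empty intersection being $W$). For a nonempty convex set $\mathscr L\subseteq W$ let $\mathrm R(\mathscr L)=\{\beta\in\Phi:\mathscr L\subseteq H_\beta^+\}$. For $i\in I$, the toggle $\tau_i\colon W\to W$ is defined by $\tau_i(u)=u$ if $u^{-1}\alpha_i\in\mathrm R(\mathscr L)$ and $\tau_i(u)=s_iu$ otherwise. A Coxeter element is a product $c=s_{i_n}\cdots s_{i_1}$ where $i_1,\ldots,i_n$ is an ordering of $I$ (each element once); $\mathrm{Pro}_c=\tau_{i_n}\cdots\tau_{i_1}$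 (composition), which depends only on $c$ and $\mathscr L$. The set $\mathscr L$ is heavy with respect to $c$ if every periodic point of $\mathrm{Pro}_c$ (i.e. every $u\in W$ with $\mathrm{Pro}_c^K(u)=u$ for some $K\ge 1$) lies in $\mathscr L$. The Coxeter group $W$ is futuristic if every nonempty convex subset of $W$ is heavy with respect to every Coxeter element of $W$. *)

theory Defs
  imports Complex_Main "HOL-Algebra.Multiplicative_Group"
begin

(* Library convention: group.ord W x = 0 iff x has infinite order.  Hence m(i,j) = \<infinity> is
   represented by 0. *)
definition coxeter_label :: "('w, 'b) monoid_scheme \<Rightarrow> ('i \<Rightarrow> 'w) \<Rightarrow> 'i \<Rightarrow> 'i \<Rightarrow> nat" where
  "coxeter_label W s i j = group.ord W (s i \<otimes>\<^bsub>W\<^esub> s j)"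

(* The word [i_1, ..., i_k] stands for the product s_{i_1} ... s_{i_k}. *)
definition word_prod :: "('w, 'b) monoid_scheme \<Rightarrow> ('i \<Rightarrow> 'w) \<Rightarrow> 'i list \<Rightarrow> 'w" where
  "word_prod W s u = foldr (\<lambda>i w. s i \<otimes>\<^bsub>W\<^esub> w) u \<one>\<^bsub>W\<^esub>"

(* Deletion of one occurrence of a relator (s_i s_j)^{m(i,j)} from a word.  For m(i,j) = \<infinity>
   (encoded by 0) the relator is the empty word, so no relation is imposed.  For i = j it is
   s_i s_i, so that inverses of generators need not be part of the alphabet. *)
inductive relator_step :: "'i set \<Rightarrow> ('i \<Rightarrow> 'i \<Rightarrow> nat) \<Rightarrow> 'i list \<Rightarrow> 'i list \<Rightarrow> bool"
  for I :: "'i set" and m :: "'i \<Rightarrow> 'i \<Rightarrow> nat" where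
  "\<lbrakk>i \<in> I; j \<in> I; u \<in> lists I; v \<in> lists I\<rbrakk>
    \<Longrightarrow> relator_step I m (u @ concat (replicate (m i j) [i, j]) @ v) (u @ v)"

(* (W, S) with S = {s i | i \<in> I}: the involutions s i (i \<in> I) generate W, and the relations
   (s_i s_j)^{m(i,j)} = 1, with m(i,j) the order of s_i s_j, are defining: two words with the
   same value in W are connected by inserting and deleting relators. *)
locale coxeter_system = group W
  for W :: "('w, 'b) monoid_scheme" (structure) +
  fixes I :: "'i set" and s :: "'i \<Rightarrow> 'w"
  assumes finite_index: "finite I"
    and generators_inj: "inj_on s I"
    and generators_carrier: "s ` I \<subseteq> carrier W"
    and generators_involution: "\<And>i. i \<in> I \<Longrightarrow> ord (s i) = 2"
    and generators_generate: "generate W (s ` I) = carrier W"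
    and presentation: "\<And>u v. \<lbrakk>u \<in> lists I; v \<in> lists I; word_prod W s u = word_prod W s v\<rbrakk>
          \<Longrightarrow> equivclp (relator_step I (coxeter_label W s)) u v"
begin

abbreviation m :: "'i \<Rightarrow> 'i \<Rightarrow> nat" where
  "m \<equiv> coxeter_label W s"

definition graph_edge :: "'i \<Rightarrow> 'i \<Rightarrow> bool" where
  "graph_edge i j \<longleftrightarrow> i \<in> I \<and> j \<in> I \<and> i \<noteq> j \<and> (m i j = 0 \<or> m i j \<ge> 3)"

definition complete_graph :: bool where
  "complete_graph \<longleftrightarrow> (\<forall>i\<in>I. \<forall>j\<in>I. i \<noteq> j \<longrightarrow> graph_edge i j)"

(* Vectors of V = \<real>^I are functions 'i => real, of which only the values on I matter. *)
definition simple_root :: "'i \<Rightarrow> 'i \<Rightarrow> real" where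
  "simple_root i = (\<lambda>j. if j = i then 1 else 0)"

definition gram :: "'i \<Rightarrow> 'i \<Rightarrow> real" where
  "gram i j = (if m i j = 0 then - 1 else - cos (pi / real (m i j)))"

definition bilin :: "('i \<Rightarrow> real) \<Rightarrow> ('i \<Rightarrow> real) \<Rightarrow> real" where
  "bilin \<beta> \<gamma> = (\<Sum>i\<in>I. \<Sum>j\<in>I. \<beta> i * \<gamma> j * gram i j)"

definition reflect :: "'i \<Rightarrow> ('i \<Rightarrow> real) \<Rightarrow> 'i \<Rightarrow> real" where
  "reflect i \<beta> = (\<lambda>j. \<beta> j - 2 * bilin \<beta> (simple_root i) * simple_root i j)"

(* w \<beta>, computed from any word for w; the reflections satisfy the defining relations of W,
   so the result does not depend on the word. *)
definition act :: "'w \<Rightarrow> ('i \<Rightarrow> real) \<Rightarrow> 'i \<Rightarrow> real" where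
  "act w \<beta> = foldr reflect (SOME u. u \<in> lists I \<and> word_prod W s u = w) \<beta>"

definition roots :: "('i \<Rightarrow> real) set" where
  "roots = {act w (simple_root i) | w i. w \<in> carrier W \<and> i \<in> I}"

definition pos_roots :: "('i \<Rightarrow> real) set" where
  "pos_roots = {\<beta> \<in> roots. \<forall>i\<in>I. \<beta> i \<ge> 0}"

definition half_space :: "('i \<Rightarrow> real) \<Rightarrow> 'w set" where
  "half_space \<beta> = {w \<in> carrier W. act w \<beta> \<in> pos_roots}"

definition convex_subset :: "'w set \<Rightarrow> bool" where
  "convex_subset L \<longleftrightarrow> (\<exists>F \<subseteq> roots. L = carrier W \<inter> (\<Inter>\<beta>\<in>F. half_space \<beta>))"

definition containing_roots :: "'w set \<Rightarrow> ('i \<Rightarrow> real) set" where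
  "containing_roots L = {\<beta> \<in> roots. L \<subseteq> half_space \<beta>}"

definition toggle :: "'w set \<Rightarrow> 'i \<Rightarrow> 'w \<Rightarrow> 'w" where
  "toggle L i u = (if act (inv u) (simple_root i) \<in> containing_roots L then u else s i \<otimes> u)"

definition index_ordering :: "'i list \<Rightarrow> bool" where
  "index_ordering xs \<longleftrightarrow> distinct xs \<and> set xs = I"

(* The ordering [i_1, ..., i_n] gives c = s_{i_n} ... s_{i_1}, hence the reversal. *)
definition coxeter_element_of :: "'i list \<Rightarrow> 'w" where
  "coxeter_element_of xs = word_prod W s (rev xs)"

definition coxeter_element :: "'w \<Rightarrow> bool" where
  "coxeter_element c \<longleftrightarrow> (\<exists>xs. index_ordering xs \<and> c = coxeter_element_of xs)"

(* toggle L i_n o ... o toggle L i_1 for xs = [i_1, ..., i_n] *)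
definition Pro :: "'w set \<Rightarrow> 'i list \<Rightarrow> 'w \<Rightarrow> 'w" where
  "Pro L xs = fold (toggle L) xs"

definition periodic_point :: "('w \<Rightarrow> 'w) \<Rightarrow> 'w \<Rightarrow> bool" where
  "periodic_point f u \<longleftrightarrow> u \<in> carrier W \<and> (\<exists>K\<ge>1. (f ^^ K) u = u)"

(* Pro L xs depends on xs only through the Coxeter element it defines, so quantifying over all
   orderings that yield c says the same as choosing one of them. *)
definition heavy :: "'w \<Rightarrow> 'w set \<Rightarrow> bool" where
  "heavy c L \<longleftrightarrow> (\<forall>xs u. index_ordering xs \<and> coxeter_element_of xs = c \<and>
      periodic_point (Pro L xs) u \<longrightarrow> u \<in> L)"

definition futuristic :: bool where
  "futuristic \<longleftrightarrow> (\<forall>L c. convex_subset L \<and> L \<noteq> {} \<and> coxeter_element c \<longrightarrow> heavy c L)"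

end

end

(* Suppose a periodic orbit u_t of Pro lies outside L. The roots separating u_t from L can only be
   lost along the orbit, so by periodicity they never change; hence a separating root that has become
   simple is never met by its own toggle.
   Since the graph is complete, a root a * alpha_x + b * alpha_y with a, b >= 1 satisfies B <= -1
   with every other simple root, and two positive roots with B <= -1 have no common inversion. This
   gives two things. First, some root separating u_t from L is simple or lies in a finite dihedral
   subsystem. Second, while such a non-simple root separates, all toggles outside its dihedral
   subsystem fix u_t, so the two toggles x and y cross alternately until the root is simple again.
   Following this root through successive dihedral subsystems, the crossings form a word along which
   the numbers f(v^-1 alpha_j) (v the product of the crossings, f the sum of the coordinates) keep a
   sign pattern, negative at the letter crossed last. So v is never 1, contradicting periodicity. *)

theory Submission
  imports Defs
begin

text \<open>The bound -1 is a threshold: for B \<le> -1 the two reflections generate an infinite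
  dihedral group, and infinitely many roots are nonnegative combinations of the two given ones,
  whereas one group element inverts only finitely many positive roots. The obstacle in the last step
  is that crossing x makes the number attached to x negative, while the one attached to y, if y was
  crossed just before, must turn positive again. The Gram matrix alone does not give this inside a
  dihedral subsystem. A conserved quantity does: f(v^-1 \<rho>) does not change when the separating
  root \<rho> and the point are reflected together. It is positive throughout, \<rho> is a
  nonnegative combination of the two simple roots, and right after a crossing of x only the share of
  y can be positive.\<close>

definition lin_comb :: "real \<Rightarrow> ('i \<Rightarrow> real) \<Rightarrow> real \<Rightarrow> ('i \<Rightarrow> real) \<Rightarrow> 'i \<Rightarrow> real" where
  "lin_comb a \<beta> b \<gamma> = (\<lambda>k. a * \<beta> k + b * \<gamma> k)"

definition neg :: "('i \<Rightarrow> real) \<Rightarrow> 'i \<Rightarrow> real" where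
  "neg \<beta> = (\<lambda>k. - \<beta> k)"

lemma neg_neg [simp]: "neg (neg \<beta>) = \<beta>"
  by (simp add: neg_def)

lemma neg_eq_lin_comb: "neg \<beta> = lin_comb (-1) \<beta> 0 \<beta>"
  by (simp add: neg_def lin_comb_def)

section \<open>The reflection representation and its independence of words\<close>

context coxeter_system
begin

lemma gen_closed [simp, intro]: "i \<in> I \<Longrightarrow> s i \<in> carrier W"
  using generators_carrier by auto

lemma gen_square: "i \<in> I \<Longrightarrow> s i \<otimes> s i = \<one>"
  using generators_involution[of i] pow_ord_eq_1[of "s i"] by (simp add: numeral_2_eq_2)

lemma gen_inv: "i \<in> I \<Longrightarrow> inv (s i) = s i"
  using gen_square gen_closed inv_equality by blast

lemma gen_cancel: "i \<in> I \<Longrightarrow> w \<in> carrier W \<Longrightarrow> s i \<otimes> (s i \<otimes> w) = w"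
  by (metis gen_square gen_closed m_assoc l_one)

lemma gen_cancel_right: "i \<in> I \<Longrightarrow> w \<in> carrier W \<Longrightarrow> (w \<otimes> s i) \<otimes> s i = w"
  by (simp add: gen_square m_assoc)

lemma m_self: "i \<in> I \<Longrightarrow> m i i = 1"
  by (simp add: coxeter_label_def gen_square)

lemma pow_m: "i \<in> I \<Longrightarrow> j \<in> I \<Longrightarrow> (s i \<otimes> s j) [^] m i j = \<one>"
  unfolding coxeter_label_def by (intro pow_ord_eq_1) auto

lemma m_sym: assumes "i \<in> I" "j \<in> I" shows "m i j = m j i"
proof -
  have "s j \<otimes> s i = inv (s i \<otimes> s j)"
    using assms by (simp add: inv_mult_group gen_inv)
  then show ?thesis
    unfolding coxeter_label_def using assms by simp
qed

lemma m_ne_1: assumes "i \<in> I" "j \<in> I" "i \<noteq> j" shows "m i j \<noteq> 1"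
proof
  assume "m i j = 1"
  then have "s i \<otimes> s j = \<one>" using pow_m[of i j] assms by simp
  then have "s i = s j" using assms by (metis gen_inv inv_equality gen_closed)
  then show False using generators_inj assms by (auto dest: inj_onD)
qed

lemma gram_self: "i \<in> I \<Longrightarrow> gram i i = 1"
  using m_self[of i] by (simp add: gram_def)

lemma gram_sym: "i \<in> I \<Longrightarrow> j \<in> I \<Longrightarrow> gram i j = gram j i"
  by (simp add: gram_def m_sym)

lemma bilin_lin_comb_left:
  "bilin (lin_comb a \<beta> b \<gamma>) \<delta> = a * bilin \<beta> \<delta> + b * bilin \<gamma> \<delta>"
  by (simp add: bilin_def lin_comb_def algebra_simps sum.distrib sum_distrib_left)

lemma bilin_sym: "bilin \<beta> \<gamma> = bilin \<gamma> \<beta>"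
proof -
  have "bilin \<beta> \<gamma> = (\<Sum>j\<in>I. \<Sum>i\<in>I. \<beta> i * \<gamma> j * gram i j)"
    unfolding bilin_def by (rule sum.swap)
  also have "\<dots> = bilin \<gamma> \<beta>"
    unfolding bilin_def by (intro sum.cong refl) (auto simp: gram_sym)
  finally show ?thesis .
qed

lemma bilin_lin_comb_right:
  "bilin \<delta> (lin_comb a \<beta> b \<gamma>) = a * bilin \<delta> \<beta> + b * bilin \<delta> \<gamma>"
  by (metis bilin_sym bilin_lin_comb_left)

lemma bilin_simple: assumes "i \<in> I" "j \<in> I"
  shows "bilin (simple_root i) (simple_root j) = gram i j"
proof -
  have "bilin (simple_root i) (simple_root j)
      = (\<Sum>p\<in>I. \<Sum>q\<in>I. if q = j then (if p = i then gram i j else 0) else 0)"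
    unfolding bilin_def simple_root_def by (intro sum.cong) auto
  then show ?thesis using assms finite_index by simp
qed

lemma reflect_eq: "reflect i \<beta> = lin_comb 1 \<beta> (- 2 * bilin \<beta> (simple_root i)) (simple_root i)"
  by (simp add: reflect_def lin_comb_def fun_eq_iff)

lemma reflect_lin_comb:
  "reflect i (lin_comb a \<beta> b \<gamma>) = lin_comb a (reflect i \<beta>) b (reflect i \<gamma>)"
  by (simp add: reflect_def fun_eq_iff bilin_lin_comb_left) (simp add: lin_comb_def algebra_simps)

lemma reflect_reflect: "i \<in> I \<Longrightarrow> reflect i (reflect i \<beta>) = \<beta>"
  by (simp add: reflect_eq bilin_lin_comb_left bilin_simple gram_self)
     (simp add: lin_comb_def algebra_simps)

lemma bilin_reflect:
  assumes "i \<in> I" shows "bilin (reflect i \<beta>) (reflect i \<gamma>) = bilin \<beta> \<gamma>"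
  using assms bilin_sym[of \<beta> "simple_root i"] bilin_sym[of "simple_root i" \<gamma>]
  by (simp add: reflect_eq bilin_lin_comb_left bilin_lin_comb_right bilin_simple gram_self algebra_simps)

lemma foldr_reflect_lin_comb:
  "foldr reflect u (lin_comb a \<beta> b \<gamma>) = lin_comb a (foldr reflect u \<beta>) b (foldr reflect u \<gamma>)"
  by (induction u) (simp_all add: reflect_lin_comb)

text \<open>In the plane of i and j vectors are parametrized by a phase, which each reflection
  advances. The new coefficient is -sin \<phi> + 2 cos \<theta> sin(\<phi> + \<theta>), a
  product-to-sum identity away from the claim.\<close>

lemma reflect_rotate:
  assumes ij: "i \<in> I" "j \<in> I" and "m i j \<noteq> 0"
  defines "\<theta> \<equiv> pi / m i j"
  shows "reflect j (lin_comb (sin (\<phi> + \<theta>)) (simple_root i) (sin \<phi>) (simple_root j))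
       = lin_comb (sin (\<phi> + \<theta>)) (simple_root i) (sin (\<phi> + 2 * \<theta>)) (simple_root j)"
proof -
  have "sin \<phi> + sin (\<phi> + 2 * \<theta>) = 2 * cos \<theta> * sin (\<phi> + \<theta>)"
    using sin_add[of "\<phi> + \<theta>" \<theta>] sin_diff[of "\<phi> + \<theta>" \<theta>] by (simp add: algebra_simps)
  then have *: "sin (\<phi> + 2 * \<theta>) = 2 * cos \<theta> * sin (\<phi> + \<theta>) - sin \<phi>" by simp
  have "gram i j = - cos \<theta>" using assms by (simp add: gram_def)
  then show ?thesis
    unfolding * using ij
    by (simp add: reflect_eq bilin_lin_comb_left bilin_simple gram_self)
       (simp add: lin_comb_def algebra_simps)
qed

lemma lin_comb_commute: "lin_comb a \<beta> b \<gamma> = lin_comb b \<gamma> a \<beta>"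
  by (simp add: lin_comb_def add.commute)

lemma foldr_concat_replicate:
  "foldr f (concat (replicate n u)) = (foldr f u) ^^ n"
  by (induction n) (simp_all add: fun_eq_iff)

lemma rotation_power:
  assumes ij: "i \<in> I" "j \<in> I" and m: "m i j \<noteq> 0"
  defines "\<theta> \<equiv> pi / m i j"
  shows "((reflect i \<circ> reflect j) ^^ n) (lin_comb (sin (\<phi> + \<theta>)) (simple_root i) (sin \<phi>) (simple_root j))
       = lin_comb (sin (\<phi> + real (2 * n) * \<theta> + \<theta>)) (simple_root i) (sin (\<phi> + real (2 * n) * \<theta>)) (simple_root j)"
proof (induction n)
  case (Suc n)
  define \<psi> where "\<psi> = \<phi> + real (2 * n) * \<theta>"
  have "((reflect i \<circ> reflect j) ^^ Suc n) (lin_comb (sin (\<phi> + \<theta>)) (simple_root i) (sin \<phi>) (simple_root j))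
     = reflect i (reflect j (lin_comb (sin (\<psi> + \<theta>)) (simple_root i) (sin \<psi>) (simple_root j)))"
    by (simp only: funpow.simps comp_apply Suc.IH \<psi>_def)
  also have "reflect j (lin_comb (sin (\<psi> + \<theta>)) (simple_root i) (sin \<psi>) (simple_root j))
     = lin_comb (sin (\<psi> + \<theta>)) (simple_root i) (sin (\<psi> + 2 * \<theta>)) (simple_root j)"
    unfolding \<theta>_def by (rule reflect_rotate[OF ij m])
  also have "\<dots> = lin_comb (sin ((\<psi> + \<theta>) + \<theta>)) (simple_root j) (sin (\<psi> + \<theta>)) (simple_root i)"
    by (subst lin_comb_commute) (simp add: algebra_simps)
  also have "reflect i \<dots> = lin_comb (sin ((\<psi> + \<theta>) + \<theta>)) (simple_root j) (sin (\<psi> + \<theta> + 2 * \<theta>)) (simple_root i)"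
    using reflect_rotate[OF ij(2,1), of "\<psi> + \<theta>"] m m_sym[OF ij] unfolding \<theta>_def by simp
  also have "\<dots> = lin_comb (sin (\<psi> + \<theta> + 2 * \<theta>)) (simple_root i) (sin ((\<psi> + \<theta>) + \<theta>)) (simple_root j)"
    by (rule lin_comb_commute)
  also have "\<psi> + \<theta> + 2 * \<theta> = \<phi> + real (2 * Suc n) * \<theta> + \<theta>" by (simp add: \<psi>_def algebra_simps)
  also have "\<psi> + \<theta> + \<theta> = \<phi> + real (2 * Suc n) * \<theta>" by (simp add: \<psi>_def algebra_simps)
  finally show ?case .
qed simp

text \<open>On the plane of i and j the relator is a rotation through a full turn. The form is
  nondegenerate there since sin \<theta> > 0, so every vector is the sum of one in the plane and one
  orthogonal to it, and the latter is fixed by both reflections.\<close>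

lemma relator_trivial:
  assumes ij: "i \<in> I" "j \<in> I"
  shows "foldr reflect (concat (replicate (m i j) [i, j])) \<beta> = \<beta>"
proof (cases "i = j")
  case True
  then show ?thesis using ij m_self by (simp add: reflect_reflect)
next
  case False
  show ?thesis
  proof (cases "m i j = 0")
    case m: False
    define \<theta> where "\<theta> = pi / m i j"
    define P where "P = foldr reflect (concat (replicate (m i j) [i, j]))"
    have P_pow: "P = (reflect i \<circ> reflect j) ^^ m i j"
      unfolding P_def foldr_concat_replicate by (simp add: fun_eq_iff comp_def)
    have m2: "m i j \<ge> 2" using m m_ne_1[OF ij False] by linarith
    have th: "0 < \<theta>" "\<theta> < pi" using m2 by (auto simp: \<theta>_def divide_less_eq)
    have sin: "sin \<theta> > 0" using th sin_gt_zero by blast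
    have fixed: "P (lin_comb (sin (\<phi> + \<theta>)) (simple_root i) (sin \<phi>) (simple_root j))
        = lin_comb (sin (\<phi> + \<theta>)) (simple_root i) (sin \<phi>) (simple_root j)" for \<phi>
    proof -
      have "real (2 * m i j) * \<theta> = 2 * pi" using m by (simp add: \<theta>_def)
      then show ?thesis
        unfolding P_pow \<theta>_def using rotation_power[OF ij m, of "m i j" \<phi>]
        by (simp add: \<theta>_def add.commute[of _ "2*pi"] add.assoc) (simp add: sin_add add.commute)
    qed
    have lin: "P (lin_comb a \<gamma> b \<delta>) = lin_comb a (P \<gamma>) b (P \<delta>)" for a b \<gamma> \<delta>
      unfolding P_def by (rule foldr_reflect_lin_comb)
    let ?v = "\<lambda>\<phi>. lin_comb (sin (\<phi> + \<theta>)) (simple_root i) (sin \<phi>) (simple_root j)"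
    have scaled: "P (lin_comb r (?v \<phi>) 0 \<beta>) = lin_comb r (?v \<phi>) 0 \<beta>" for r \<phi>
      by (simp only: lin[of r "?v \<phi>" 0 \<beta>] fixed) (simp add: lin_comb_def)
    \<comment> \<open>At the phases 0 and -\<theta> one of the two coefficients vanishes, which
      isolates each simple root in turn.\<close>
    have "lin_comb (1 / sin \<theta>) (?v 0) 0 \<beta> = simple_root i"
      using sin by (simp add: lin_comb_def)
    then have Pi: "P (simple_root i) = simple_root i"
      using scaled[of "1 / sin \<theta>" 0] by (simp only:)
    have "lin_comb (- 1 / sin \<theta>) (?v (- \<theta>)) 0 \<beta> = simple_root j"
      using sin by (simp add: lin_comb_def)
    then have Pj: "P (simple_root j) = simple_root j"
      using scaled[of "- 1 / sin \<theta>" "- \<theta>"] by (simp only:)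
    define c p q where "c = cos \<theta>" and "p = bilin \<beta> (simple_root i)" and "q = bilin \<beta> (simple_root j)"
    \<comment> \<open>These solve the Gram system a - c b = p, b - c a = q, whose determinant is 1 -
      c^2 = (sin \<theta>)^2; they make \<open>\<beta>'\<close> orthogonal to both simple
      roots.\<close>
    define a b where "a = (p + c * q) / (1 - c^2)" and "b = (q + c * p) / (1 - c^2)"
    define \<beta>' where "\<beta>' = lin_comb 1 \<beta> (-1) (lin_comb a (simple_root i) b (simple_root j))"
    have c2: "1 - c^2 \<noteq> 0" using sin by (simp add: c_def cos_squared_eq)
    have g: "gram i j = - c" "gram j i = - c"
      using m gram_sym[OF ij] by (auto simp: gram_def c_def \<theta>_def)
    have "bilin \<beta>' (simple_root i) = p - a + c * b"
      using ij g by (simp add: \<beta>'_def bilin_lin_comb_left bilin_simple gram_self p_def)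
    also have "\<dots> = 0" using c2 by (simp add: a_def b_def field_simps power2_eq_square)
    finally have z1: "bilin \<beta>' (simple_root i) = 0" .
    have "bilin \<beta>' (simple_root j) = q + c * a - b"
      using ij g by (simp add: \<beta>'_def bilin_lin_comb_left bilin_simple gram_self q_def)
    also have "\<dots> = 0" using c2 by (simp add: a_def b_def field_simps power2_eq_square)
    finally have z2: "bilin \<beta>' (simple_root j) = 0" .
    have r: "reflect i \<beta>' = \<beta>'" "reflect j \<beta>' = \<beta>'"
      using z1 z2 by (simp_all add: reflect_def)
    have "((reflect i \<circ> reflect j) ^^ n) \<beta>' = \<beta>'" for n
      by (induction n) (simp_all add: r)
    then have Pb: "P \<beta>' = \<beta>'" by (simp add: P_pow)
    have "\<beta> = lin_comb 1 \<beta>' 1 (lin_comb a (simple_root i) b (simple_root j))"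
      by (simp add: \<beta>'_def lin_comb_def)
    then have "P \<beta> = \<beta>" by (metis lin Pi Pj Pb)
    then show ?thesis by (simp add: P_def)
  qed simp
qed

lemma word_prod_simps [simp]:
  "word_prod W s [] = \<one>" "word_prod W s (i # u) = s i \<otimes> word_prod W s u"
  by (simp_all add: word_prod_def)

lemma word_prod_closed [simp, intro]: "u \<in> lists I \<Longrightarrow> word_prod W s u \<in> carrier W"
  by (induction u) auto

lemma word_prod_append:
  "u \<in> lists I \<Longrightarrow> v \<in> lists I \<Longrightarrow> word_prod W s (u @ v) = word_prod W s u \<otimes> word_prod W s v"
  by (induction u) (auto simp: m_assoc)

text \<open>By the presentation it suffices to delete one relator, and relators act trivially. This
  frees \<open>act\<close> from the word chosen by \<open>SOME\<close>.\<close>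

lemma foldr_reflect_cong:
  assumes "u \<in> lists I" "v \<in> lists I" "word_prod W s u = word_prod W s v"
  shows "foldr reflect u = foldr reflect v"
proof -
  have "equivclp (relator_step I m) u v" using presentation assms by blast
  then show ?thesis
  proof (induction rule: equivclp_induct)
    case (step y z)
    have *: "relator_step I m y' z' \<Longrightarrow> foldr reflect y' = foldr reflect z'" for y' z'
      by (induction rule: relator_step.induct) (simp add: fun_eq_iff relator_trivial)
    show ?case using step.hyps(2) step.IH *[of y z] *[of z y] by auto
  qed simp
qed

text \<open>Every relator has even length. This is the sign character in terms of words; it shows
  that a generator always changes the length.\<close>

lemma even_length_cong:
  assumes "u \<in> lists I" "v \<in> lists I" "word_prod W s u = word_prod W s v"
  shows "even (length u) = even (length v)"
proof -
  have "equivclp (relator_step I m) u v" using presentation assms by blast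
  then show ?thesis
  proof (induction rule: equivclp_induct)
    case (step y z)
    have ev: "even (length (concat (replicate n [i, j])))" for n and i j :: 'i
      by (induction n) auto
    have *: "relator_step I m y' z' \<Longrightarrow> even (length y') = even (length z')" for y' z'
      by (induction rule: relator_step.induct) (use ev in auto)
    show ?case using step.hyps(2) step.IH *[of y z] *[of z y] by auto
  qed simp
qed

lemma ex_word: assumes "w \<in> carrier W" shows "\<exists>u\<in>lists I. word_prod W s u = w"
proof -
  have "w \<in> generate W (s ` I)" using assms generators_generate by simp
  then show ?thesis
  proof (induction rule: generate.induct)
    case one
    show ?case by (rule bexI[of _ "[]"]) auto
  next
    case (incl h)
    then obtain i where "i \<in> I" "h = s i" by auto
    then show ?case by (intro bexI[of _ "[i]"]) auto
  next
    case (inv h)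
    then obtain i where "i \<in> I" "h = s i" by auto
    then show ?case by (intro bexI[of _ "[i]"]) (auto simp: gen_inv)
  next
    case (eng h1 h2)
    then show ?case by (metis word_prod_append append_in_lists_conv)
  qed
qed

lemma act_word: assumes "u \<in> lists I" shows "act (word_prod W s u) = foldr reflect u"
proof -
  let ?v = "SOME v. v \<in> lists I \<and> word_prod W s v = word_prod W s u"
  have "?v \<in> lists I \<and> word_prod W s ?v = word_prod W s u"
    by (rule someI) (use assms in auto)
  then have "foldr reflect ?v = foldr reflect u"
    using foldr_reflect_cong assms by blast
  then show ?thesis by (simp add: act_def fun_eq_iff)
qed

lemma act_one [simp]: "act \<one> \<beta> = \<beta>"
  using act_word[of "[]"] by simp

lemma act_gen: "i \<in> I \<Longrightarrow> act (s i) = reflect i"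
  using act_word[of "[i]"] by (simp add: fun_eq_iff)

lemma act_mult: assumes "v \<in> carrier W" "w \<in> carrier W" shows "act (v \<otimes> w) \<beta> = act v (act w \<beta>)"
proof -
  obtain x y where "x \<in> lists I" "word_prod W s x = v" "y \<in> lists I" "word_prod W s y = w"
    using ex_word assms by metis
  then show ?thesis using act_word[of "x @ y"] act_word[of x] act_word[of y] word_prod_append[of x y]
    by auto
qed

lemma act_inv_left [simp]: "w \<in> carrier W \<Longrightarrow> act (inv w) (act w \<beta>) = \<beta>"
  by (metis act_mult act_one inv_closed l_inv)

lemma act_inv_right [simp]: "w \<in> carrier W \<Longrightarrow> act w (act (inv w) \<beta>) = \<beta>"
  by (metis act_mult act_one inv_closed r_inv)

lemma act_lin_comb:
  "act w (lin_comb a \<beta> b \<gamma>) = lin_comb a (act w \<beta>) b (act w \<gamma>)"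
  by (simp add: act_def foldr_reflect_lin_comb)

lemma act_neg: "act w (neg \<beta>) = neg (act w \<beta>)"
  by (simp add: neg_eq_lin_comb act_lin_comb)

lemma bilin_act: assumes "w \<in> carrier W" shows "bilin (act w \<beta>) (act w \<gamma>) = bilin \<beta> \<gamma>"
proof -
  obtain u where "u \<in> lists I" "word_prod W s u = w" using ex_word assms by metis
  then have "act w = foldr reflect u" using act_word by auto
  moreover have "bilin (foldr reflect u \<beta>) (foldr reflect u \<gamma>) = bilin \<beta> \<gamma>"
    using \<open>u \<in> lists I\<close> by (induction u) (simp_all add: bilin_reflect)
  ultimately show ?thesis by simp
qed

lemma reflect_simple: "i \<in> I \<Longrightarrow> reflect i (simple_root i) = neg (simple_root i)"
  by (simp add: reflect_eq bilin_simple gram_self) (simp add: lin_comb_def neg_def)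

end

section \<open>Positivity of roots\<close>

text \<open>The label \<open>p = 0\<close> stands for infinity; \<open>p = 1\<close> gives the junk value \<open>0\<close>.\<close>

definition cheb :: "nat \<Rightarrow> nat \<Rightarrow> real" where
  "cheb p k = (if p = 0 then real k else sin (real k * (pi / real p)) / sin (pi / real p))"

lemma cheb_0 [simp]: "cheb p 0 = 0"
  by (simp add: cheb_def)

lemma sin_pi_div_pos: "2 \<le> p \<Longrightarrow> 0 < sin (pi / real p)"
  by (rule sin_gt_zero) (auto simp: divide_less_eq)

lemma cheb_1 [simp]: "p \<noteq> 1 \<Longrightarrow> cheb p (Suc 0) = 1"
  using sin_pi_div_pos[of p] by (cases "p = 0") (auto simp: cheb_def)

lemma cheb_Suc_Suc:
  "cheb p (Suc (Suc k)) = 2 * (if p = 0 then 1 else cos (pi / real p)) * cheb p (Suc k) - cheb p k"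
proof (cases "p = 0")
  case False
  define t where "t = pi / real p"
  have "sin (real (Suc (Suc k)) * t) = 2 * cos t * sin (real (Suc k) * t) - sin (real k * t)"
    using sin_add[of "real (Suc k) * t" t] sin_diff[of "real (Suc k) * t" t]
    by (simp add: algebra_simps)
  then show ?thesis using False by (simp add: cheb_def t_def diff_divide_distrib)
qed (simp add: cheb_def)

lemma cheb_nonneg: assumes "p \<noteq> 1" "p = 0 \<or> k \<le> p" shows "0 \<le> cheb p k"
proof (cases "p = 0")
  case False
  have "0 \<le> sin (real k * (pi / real p))"
    by (rule sin_ge_zero) (use assms False in \<open>auto simp: field_simps\<close>)
  then show ?thesis using sin_pi_div_pos[of p] assms False by (simp add: cheb_def)
qed (simp add: cheb_def)

lemma cheb_reverse: assumes "k \<le> p" "p \<noteq> 0" shows "cheb p (p - k) = cheb p k"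
proof -
  have "real (p - k) * (pi / real p) = pi - real k * (pi / real p)"
    using assms by (auto simp: of_nat_diff field_simps)
  then show ?thesis using assms(2) unfolding cheb_def by (simp only: sin_pi_minus) simp
qed

text \<open>For 2k \<le> p the angles stay in [0, \<pi>/2], where the sine increases, so the
  numerator is at least its value at k = 1. The other half follows by the symmetry k to p -
  k.\<close>

lemma cheb_ge_1: assumes "0 < k" "k < p" shows "1 \<le> cheb p k"
proof -
  have *: "sin (pi / real p) \<le> sin (real l * (pi / real p))" if "0 < l" "2 * l \<le> p" for l
  proof (rule sin_monotone_2pi_le)
    have "real l * 2 \<le> real p" using that by linarith
    then show "real l * (pi / real p) \<le> pi / 2" using that assms by (simp add: field_simps)
    have "1 \<le> real l" using that by linarith
    then have "1 * (pi / real p) \<le> real l * (pi / real p)" by (rule mult_right_mono) simp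
    then show "pi / real p \<le> real l * (pi / real p)" by simp
    have "0 \<le> pi / real p" by simp
    then show "- (pi / 2) \<le> pi / real p" using pi_gt_zero by linarith
  qed
  have s: "0 < sin (pi / real p)" using assms by (intro sin_pi_div_pos) auto
  have **: "1 \<le> cheb p l" if "0 < l" "2 * l \<le> p" for l
    using *[OF that] s assms by (simp add: cheb_def)
  show ?thesis
  proof (cases "2 * k \<le> p")
    case False
    then have "1 \<le> cheb p (p - k)" using assms by (intro **) auto
    then show ?thesis using cheb_reverse[of k p] assms by simp
  qed (use ** assms in auto)
qed

text \<open>Alternating words are normalized by their last letter, the one that acts first under
  \<open>foldr\<close>; the first letter then depends on the parity of the length.\<close>

primrec alt :: "'a \<Rightarrow> 'a \<Rightarrow> nat \<Rightarrow> 'a list" where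
  "alt x y 0 = []"
| "alt x y (Suc n) = alt y x n @ [x]"

lemma alt_Suc_front: "alt x y (Suc n) = (if even n then x else y) # alt x y n"
  by (induction n arbitrary: x y) auto

lemma length_alt [simp]: "length (alt x y n) = n"
  by (induction n arbitrary: x y) auto

lemma alt_in_lists [simp]: "x \<in> I \<Longrightarrow> y \<in> I \<Longrightarrow> alt x y n \<in> lists I"
  by (induction n arbitrary: x y) auto

lemma alt_add: "alt x y (p + n) = (if even n then alt x y p else alt y x p) @ alt x y n"
  by (induction n arbitrary: x y) auto

context coxeter_system
begin

text \<open>For \<open>k < m x y\<close> these are the positive roots of the dihedral subgroup of \<open>x\<close> and \<open>y\<close>,
  and reflecting in \<open>x\<close> and \<open>y\<close> alternately runs through them.\<close>

definition dih :: "'i \<Rightarrow> 'i \<Rightarrow> nat \<Rightarrow> 'i \<Rightarrow> real" where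
  "dih x y k = lin_comb (cheb (m x y) k) (simple_root x) (cheb (m x y) (Suc k)) (simple_root y)"

definition nonneg :: "('i \<Rightarrow> real) \<Rightarrow> bool" where
  "nonneg \<beta> \<longleftrightarrow> (\<forall>k\<in>I. 0 \<le> \<beta> k)"

lemma gram_eq: "gram x y = - (if m x y = 0 then 1 else cos (pi / real (m x y)))"
  by (simp add: gram_def)

lemma reflect_dih: assumes "x \<in> I" "y \<in> I" shows "reflect x (dih x y k) = dih y x (Suc k)"
proof -
  have "cheb (m x y) (Suc (Suc k)) = - 2 * gram x y * cheb (m x y) (Suc k) - cheb (m x y) k"
    unfolding cheb_Suc_Suc gram_eq by simp
  then show ?thesis
    using assms m_sym[OF assms] gram_sym[OF assms]
    by (simp add: dih_def reflect_eq bilin_lin_comb_left bilin_simple gram_self)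
       (simp add: lin_comb_def algebra_simps)
qed

lemma reflect_dih_Suc: "x \<in> I \<Longrightarrow> y \<in> I \<Longrightarrow> reflect y (dih x y (Suc k)) = dih y x k"
  by (metis reflect_dih reflect_reflect)

lemma dih_0: "x \<in> I \<Longrightarrow> y \<in> I \<Longrightarrow> x \<noteq> y \<Longrightarrow> dih x y 0 = simple_root y"
  using m_ne_1[of x y] by (simp add: dih_def lin_comb_def)

text \<open>A positive root of a finite dihedral system has two names, one counted from each of the
  two simple roots.\<close>

lemma dih_reverse:
  assumes "x \<in> I" "y \<in> I" "m x y \<noteq> 0" "k < m x y"
  shows "dih x y k = dih y x (m x y - Suc k)"
proof -
  have "Suc (m x y - Suc k) = m x y - k" using assms by simp
  then show ?thesis
    using assms cheb_reverse[of k "m x y"] cheb_reverse[of "Suc k" "m x y"] m_sym[of x y]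
    by (simp add: dih_def lin_comb_commute[of "cheb (m y x) (Suc k)"])
qed

lemma dih_nonneg:
  assumes "x \<in> I" "y \<in> I" "x \<noteq> y" "m x y = 0 \<or> k < m x y" "nonneg \<beta>" "nonneg \<gamma>"
  shows "nonneg (lin_comb (cheb (m x y) k) \<beta> (cheb (m x y) (Suc k)) \<gamma>)"
  using assms cheb_nonneg[of "m x y" k] cheb_nonneg[of "m x y" "Suc k"] m_ne_1[of x y]
  by (auto simp: nonneg_def lin_comb_def)

lemma nonneg_simple [simp]: "nonneg (simple_root i)"
  by (simp add: nonneg_def simple_root_def)

lemma foldr_alt_dih:
  assumes "x \<in> I" "y \<in> I"
  shows "foldr reflect (alt x y n) (dih x y k) = (if even n then dih x y (k + n) else dih y x (k + n))"
  using assms by (induction n arbitrary: x y k) (auto simp: reflect_dih)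

section \<open>Length and the braid relation\<close>

definition len :: "'w \<Rightarrow> nat" where
  "len w = (LEAST n. \<exists>u\<in>lists I. length u = n \<and> word_prod W s u = w)"

lemma len_le: "u \<in> lists I \<Longrightarrow> len (word_prod W s u) \<le> length u"
  unfolding len_def by (rule Least_le) auto

lemma ex_reduced:
  assumes "w \<in> carrier W" shows "\<exists>u\<in>lists I. length u = len w \<and> word_prod W s u = w"
  unfolding len_def by (rule LeastI_ex) (use ex_word[OF assms] in auto)

lemma len_mult_word: assumes "w \<in> carrier W" "u \<in> lists I"
  shows "len (w \<otimes> word_prod W s u) \<le> len w + length u"
proof -
  obtain v where "v \<in> lists I" "length v = len w" "word_prod W s v = w"
    using ex_reduced assms by blast
  then show ?thesis using len_le[of "v @ u"] assms by (simp add: word_prod_append)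
qed

lemma len_mult_gen_le: "w \<in> carrier W \<Longrightarrow> i \<in> I \<Longrightarrow> len (w \<otimes> s i) \<le> Suc (len w)"
  using len_mult_word[of w "[i]"] by simp

lemma len_mult_gen_ne: assumes "w \<in> carrier W" "i \<in> I" shows "len (w \<otimes> s i) \<noteq> len w"
proof
  assume eq: "len (w \<otimes> s i) = len w"
  obtain u v where "u \<in> lists I" "length u = len w" "word_prod W s u = w"
    "v \<in> lists I" "length v = len (w \<otimes> s i)" "word_prod W s v = w \<otimes> s i"
    using ex_reduced assms by (metis gen_closed m_closed)
  then show False using eq even_length_cong[of "u @ [i]" v] assms by (simp add: word_prod_append)
qed

lemma len_eq_0: "w \<in> carrier W \<Longrightarrow> len w = 0 \<Longrightarrow> w = \<one>"
  using ex_reduced[of w] by auto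

text \<open>Exchanging the two letters costs a power of s_y s_x, which is trivial for n = m(x,y).
  This gives the braid relation without a case split on the parity of m(x,y).\<close>

lemma alt_word_twist:
  assumes "x \<in> I" "y \<in> I"
  shows "word_prod W s (alt x y n) = word_prod W s (alt y x n) \<otimes> (s y \<otimes> s x) [^] n"
  using assms
proof (induction n arbitrary: x y)
  case (Suc n)
  have c: "s x \<in> carrier W" "s y \<in> carrier W" "(s y \<otimes> s x) [^] n \<in> carrier W"
    "word_prod W s (alt y x n) \<in> carrier W" "word_prod W s (alt x y n) \<in> carrier W"
    using Suc.prems by auto
  have shift: "s y \<otimes> (s y \<otimes> s x) [^] Suc n = s x \<otimes> (s y \<otimes> s x) [^] n"
    using c Suc.prems by (subst nat_pow_Suc2) (auto simp: m_assoc gen_cancel)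
  have twist: "s x \<otimes> (s y \<otimes> s x) [^] k = (s x \<otimes> s y) [^] k \<otimes> s x" for k :: nat
  proof (induction k)
    case (Suc k)
    have "s x \<otimes> (s y \<otimes> s x) [^] Suc k = (s x \<otimes> (s y \<otimes> s x) [^] k) \<otimes> (s y \<otimes> s x)"
      using c by (simp add: m_assoc)
    then show ?case unfolding Suc.IH using c by (simp add: m_assoc)
  qed (use c in simp)
  have "word_prod W s (alt y x (Suc n)) \<otimes> (s y \<otimes> s x) [^] Suc n
      = word_prod W s (alt x y n) \<otimes> (s y \<otimes> (s y \<otimes> s x) [^] Suc n)"
    using c Suc.prems by (simp add: word_prod_append m_assoc del: nat_pow_Suc)
  also have "\<dots> = word_prod W s (alt x y n) \<otimes> (s x \<otimes> (s y \<otimes> s x) [^] n)"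
    unfolding shift ..
  also have "s x \<otimes> (s y \<otimes> s x) [^] n = (s x \<otimes> s y) [^] n \<otimes> s x"
    by (rule twist)
  also have "word_prod W s (alt x y n) \<otimes> ((s x \<otimes> s y) [^] n \<otimes> s x)
     = word_prod W s (alt y x n) \<otimes> s x"
    using Suc.IH[of y x] Suc.prems c by (simp add: m_assoc)
  finally show ?case using Suc.prems by (simp add: word_prod_append)
qed simp

lemma braid:
  assumes "x \<in> I" "y \<in> I"
  shows "word_prod W s (alt x y (m x y)) = word_prod W s (alt y x (m x y))"
  using alt_word_twist[OF assms, of "m x y"] pow_m[of y x] m_sym[OF assms] assms by simp

text \<open>Split off from \<open>w\<close> the longest alternating suffix in \<open>i\<close> and the last letter \<open>j\<close> of a reduced
  word; the remaining prefix is shorter and increases in length under both \<open>i\<close> and \<open>j\<close>.\<close>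

theorem act_simple_nonneg:
  assumes "w \<in> carrier W" "i \<in> I" "len w < len (w \<otimes> s i)"
  shows "nonneg (act w (simple_root i))"
  using assms
proof (induction "len w" arbitrary: w i rule: less_induct)
  case less
  note w = \<open>w \<in> carrier W\<close> and i = \<open>i \<in> I\<close>
  show ?case
  proof (cases "len w = 0")
    case True
    then have "w = \<one>" using len_eq_0 w by blast
    then show ?thesis by simp
  next
    case False
    obtain u where u: "u \<in> lists I" "length u = len w" "word_prod W s u = w"
      using ex_reduced w by blast
    then obtain u' j where uj: "u = u' @ [j]" using False by (cases u rule: rev_cases) auto
    have j: "j \<in> I" "u' \<in> lists I" using u uj by auto
    have wj: "w = word_prod W s u' \<otimes> s j" using u uj j by (simp add: word_prod_append)
    have "i \<noteq> j"
    proof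
      assume "i = j"
      then have "w \<otimes> s i = word_prod W s u'" using wj j by (simp add: gen_cancel_right)
      then show False using len_le[of u'] j u uj less.prems by simp
    qed
    define Q where "Q k \<longleftrightarrow> (\<exists>v\<in>carrier W. w = v \<otimes> word_prod W s (alt j i k) \<and> len v + k = len w)" for k
    have "len w \<le> Suc (len (word_prod W s u'))" using wj len_mult_gen_le j by simp
    then have "Q 1" unfolding Q_def using wj j len_le[of u'] u uj
      by (intro bexI[of _ "word_prod W s u'"]) auto
    moreover have "\<forall>k. Q k \<longrightarrow> k < Suc (len w)" by (auto simp: Q_def)
    ultimately obtain k where k: "Q k" and kmax: "\<And>k'. Q k' \<Longrightarrow> k' \<le> k"
      using ex_has_greatest_nat[of Q 1 "\<lambda>k. k" "Suc (len w)"] by blast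
    obtain v where v: "v \<in> carrier W" "w = v \<otimes> word_prod W s (alt j i k)" "len v + k = len w"
      using k by (auto simp: Q_def)
    have "1 \<le> k" using kmax \<open>Q 1\<close> by blast
    then obtain k' where k': "k = Suc k'" by (cases k) auto
    have wpc: "word_prod W s (alt j i n) \<in> carrier W" for n using i j by simp
    \<comment> \<open>\<open>a\<close> is the letter that would prolong the alternating suffix to
      the left, and \<open>b\<close> is the present first letter of that suffix. A descent of v at
      \<open>a\<close> contradicts the maximality of k, a descent at \<open>b\<close> the length of
      w.\<close>
    define a b where "a = (if even k then j else i)" and "b = (if even k' then j else i)"
    have ab: "a \<in> I" "b \<in> I" using i j by (auto simp: a_def b_def)
    have up_a: "len v < len (v \<otimes> s a)"
    proof (rule ccontr)
      assume "\<not> ?thesis"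
      then have lt: "len (v \<otimes> s a) < len v" using len_mult_gen_ne[OF v(1) ab(1)] by linarith
      have "len v \<le> Suc (len (v \<otimes> s a))"
        using len_mult_gen_le[of "v \<otimes> s a" a] v ab by (simp add: gen_cancel_right)
      moreover have "w = (v \<otimes> s a) \<otimes> word_prod W s (alt j i (Suc k))"
        unfolding alt_Suc_front using v ab wpc by (simp add: a_def[symmetric] m_assoc gen_cancel)
      ultimately have "Q (Suc k)" unfolding Q_def using v ab lt by (intro bexI[of _ "v \<otimes> s a"]) auto
      then show False using kmax by fastforce
    qed
    have up_b: "len v < len (v \<otimes> s b)"
    proof (rule ccontr)
      assume "\<not> ?thesis"
      then have lt: "len (v \<otimes> s b) < len v" using len_mult_gen_ne[OF v(1) ab(2)] by linarith
      have "w = (v \<otimes> s b) \<otimes> word_prod W s (alt j i k')"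
        using v(2) unfolding k' alt_Suc_front using v ab wpc by (simp add: b_def[symmetric] m_assoc)
      then have "len w \<le> len (v \<otimes> s b) + k'"
        using len_mult_word[of "v \<otimes> s b" "alt j i k'"] v ab i j by simp
      then show False using lt v(3) k' by simp
    qed
    have "{a, b} = {i, j}" by (auto simp: a_def b_def k')
    then have "len v < len (v \<otimes> s i)" "len v < len (v \<otimes> s j)" using up_a up_b by (auto simp: doubleton_eq_iff)
    moreover have "len v < len w" using v(3) \<open>1 \<le> k\<close> by linarith
    ultimately have nn: "nonneg (act v (simple_root i))" "nonneg (act v (simple_root j))"
      using less.hyps v(1) i j by blast+
    \<comment> \<open>Otherwise a braid move on the last m(j,i) letters makes the word end in i, and
      multiplying by s_i shortens it.\<close>
    have km: "m j i = 0 \<or> k < m j i"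
    proof (rule ccontr)
      assume "\<not> ?thesis"
      then have "m j i \<noteq> 0" "m j i \<le> k" by auto
      then obtain p where p: "k = p + m j i" by (metis add.commute le_Suc_ex)
      obtain n where n: "m j i = Suc n" using \<open>m j i \<noteq> 0\<close> by (cases "m j i") auto
      define z where "z = (if even (m j i) then alt j i p else alt i j p) @ alt j i n"
      have z: "z \<in> lists I" "length z = p + n" using i j by (auto simp: z_def)
      have "word_prod W s (alt j i k) = word_prod W s (if even (m j i) then alt j i p else alt i j p) \<otimes> word_prod W s (alt i j (m j i))"
        unfolding p alt_add using i j braid[of j i] by (simp add: word_prod_append)
      also have "\<dots> = word_prod W s z \<otimes> s i"
        unfolding n z_def using i j by (simp add: word_prod_append m_assoc)
      finally have "w \<otimes> s i = v \<otimes> word_prod W s z"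
        using v i z by (simp add: m_assoc gen_cancel_right gen_square)
      then have "len (w \<otimes> s i) \<le> len v + (p + n)" using len_mult_word[of v z] v z by simp
      then show False using less.prems v(3) p n by linarith
    qed
    have "act w (simple_root i) = act v (foldr reflect (alt j i k) (dih j i 0))"
      using v i j \<open>i \<noteq> j\<close> act_word[of "alt j i k"] by (simp add: act_mult dih_0)
    also have "\<dots> = act v (if even k then dih j i k else dih i j k)"
      using foldr_alt_dih[of j i k 0] i j by simp
    finally have eq: "act w (simple_root i) = act v (if even k then dih j i k else dih i j k)" .
    show ?thesis
      unfolding eq using dih_nonneg[of j i k, OF _ _ _ _ nn(2,1)] dih_nonneg[of i j k, OF _ _ _ _ nn] km i j \<open>i \<noteq> j\<close>
        m_sym[of i j] by (auto simp: dih_def act_lin_comb)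
  qed
qed

section \<open>Positive roots and inversions\<close>

lemma simple_in_roots: "i \<in> I \<Longrightarrow> simple_root i \<in> roots"
  unfolding roots_def by (auto intro!: exI[of _ \<one>] exI[of _ i])

lemma act_in_roots: assumes "w \<in> carrier W" "\<beta> \<in> roots" shows "act w \<beta> \<in> roots"
proof -
  obtain v i where "v \<in> carrier W" "i \<in> I" "\<beta> = act v (simple_root i)"
    using assms by (auto simp: roots_def)
  then show ?thesis using assms unfolding roots_def
    by (auto simp: act_mult intro!: exI[of _ "w \<otimes> v"] exI[of _ i])
qed

lemma reflect_in_roots: "i \<in> I \<Longrightarrow> \<beta> \<in> roots \<Longrightarrow> reflect i \<beta> \<in> roots"
  using act_in_roots[of "s i"] by (simp add: act_gen)

lemma neg_in_roots: assumes "\<beta> \<in> roots" shows "neg \<beta> \<in> roots"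
proof -
  obtain v i where v: "v \<in> carrier W" "i \<in> I" "\<beta> = act v (simple_root i)"
    using assms by (auto simp: roots_def)
  then have "neg \<beta> = act (v \<otimes> s i) (simple_root i)"
    by (simp add: act_mult act_gen reflect_simple act_neg)
  then show ?thesis using v unfolding roots_def by blast
qed

lemma bilin_root: "\<beta> \<in> roots \<Longrightarrow> bilin \<beta> \<beta> = 1"
  by (auto simp: roots_def bilin_act bilin_simple gram_self)

text \<open>Vectors are total functions, so identifying a root with a simple root as functions also
  requires its values off \<open>I\<close>.\<close>

lemma root_off: assumes "\<beta> \<in> roots" "k \<notin> I" shows "\<beta> k = 0"
proof -
  obtain v i where v: "v \<in> carrier W" "i \<in> I" "\<beta> = act v (simple_root i)"
    using assms by (auto simp: roots_def)
  obtain u where u: "u \<in> lists I" "word_prod W s u = v" using ex_word v by blast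
  have "foldr reflect u (simple_root i) k = 0"
    using u(1) by (induction u) (use v assms in \<open>auto simp: simple_root_def reflect_def\<close>)
  then show ?thesis using act_word[OF u(1)] u v by simp
qed

lemma pos_roots_iff: "\<beta> \<in> pos_roots \<longleftrightarrow> \<beta> \<in> roots \<and> nonneg \<beta>"
  by (auto simp: pos_roots_def nonneg_def)

lemma root_pos_or_neg: assumes "\<beta> \<in> roots" shows "\<beta> \<in> pos_roots \<or> neg \<beta> \<in> pos_roots"
proof -
  obtain w i where w: "w \<in> carrier W" "i \<in> I" "\<beta> = act w (simple_root i)"
    using assms by (auto simp: roots_def)
  show ?thesis
  proof (cases "len w < len (w \<otimes> s i)")
    case True
    then show ?thesis using act_simple_nonneg w assms by (simp add: pos_roots_iff)
  next
    case False
    then have "len (w \<otimes> s i) < len (w \<otimes> s i \<otimes> s i)"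
      using len_mult_gen_ne[of w i] w by (simp add: gen_cancel_right)
    then have "nonneg (act (w \<otimes> s i) (simple_root i))" using w by (intro act_simple_nonneg) auto
    then show ?thesis using w assms neg_in_roots
      by (simp add: pos_roots_iff act_mult act_gen reflect_simple act_neg)
  qed
qed

lemma root_nonzero: assumes "\<beta> \<in> roots" shows "\<exists>k\<in>I. \<beta> k \<noteq> 0"
proof (rule ccontr)
  assume "\<not> ?thesis"
  then have "bilin \<beta> \<beta> = 0" by (simp add: bilin_def)
  then show False using bilin_root assms by simp
qed

lemma neg_in_pos_roots_iff: assumes "\<beta> \<in> roots" shows "neg \<beta> \<in> pos_roots \<longleftrightarrow> \<beta> \<notin> pos_roots"
proof -
  have "\<not> (\<beta> \<in> pos_roots \<and> neg \<beta> \<in> pos_roots)"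
    using root_nonzero[OF assms] by (force simp: pos_roots_iff nonneg_def neg_def)
  then show ?thesis using root_pos_or_neg assms by blast
qed

lemma simple_in_pos_roots: "i \<in> I \<Longrightarrow> simple_root i \<in> pos_roots"
  by (simp add: pos_roots_iff simple_in_roots)

text \<open>Only coordinate i changes, so a positive coordinate elsewhere survives and decides the
  sign. A positive root supported at i alone is a multiple of \<alpha>_i, and equals it because
  B(\<beta>,\<beta>) = 1.\<close>

lemma reflect_pos:
  assumes \<beta>: "\<beta> \<in> pos_roots" and i: "i \<in> I" and ne: "\<beta> \<noteq> simple_root i"
  shows "reflect i \<beta> \<in> pos_roots"
proof -
  have root: "\<beta> \<in> roots" using \<beta> by (simp add: pos_roots_iff)
  have "\<exists>k\<in>I. k \<noteq> i \<and> \<beta> k > 0"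
  proof (rule ccontr)
    assume "\<not> ?thesis"
    then have z: "\<beta> k = 0" if "k \<noteq> i" for k
      using that \<beta> root_off[OF root] by (cases "k \<in> I") (force simp: pos_roots_def)+
    then have eq: "\<beta> = lin_comb (\<beta> i) (simple_root i) 0 \<beta>"
      by (auto simp: lin_comb_def simple_root_def)
    then have "bilin \<beta> \<beta> = \<beta> i * \<beta> i"
      using i by (metis (no_types) add.right_neutral bilin_lin_comb_left bilin_lin_comb_right bilin_simple gram_self mult.right_neutral mult_zero_left)
    then have "\<beta> i = 1" using bilin_root[OF root] \<beta> i
      by (simp add: square_eq_1_iff pos_roots_def) fastforce
    then show False using ne eq by (simp add: lin_comb_def)
  qed
  then obtain k where k: "k \<in> I" "k \<noteq> i" "\<beta> k > 0" by blast
  have "reflect i \<beta> k = \<beta> k" using k by (simp add: reflect_def simple_root_def)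
  then have "\<not> neg (reflect i \<beta>) \<in> pos_roots" using k by (force simp: pos_roots_def neg_def)
  then show ?thesis using root_pos_or_neg reflect_in_roots i root by blast
qed

lemma act_simple_neg:
  assumes "w \<in> carrier W" "i \<in> I" "len (w \<otimes> s i) < len w"
  shows "act w (simple_root i) \<notin> pos_roots"
proof -
  have "nonneg (act (w \<otimes> s i) (simple_root i))"
    using assms by (intro act_simple_nonneg) (auto simp: gen_cancel_right)
  moreover have "act (w \<otimes> s i) (simple_root i) = neg (act w (simple_root i))"
    using assms by (simp add: act_mult act_gen reflect_simple act_neg)
  ultimately show ?thesis
    using assms neg_in_pos_roots_iff[of "act w (simple_root i)"] act_in_roots simple_in_roots neg_in_roots
    by (simp add: pos_roots_iff)
qed

text \<open>By \<open>reflect_pos\<close> each further letter of a word adds at most one inversion,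
  its own simple root.\<close>

lemma finite_inversions:
  assumes "w \<in> carrier W" shows "finite {\<gamma> \<in> pos_roots. act w \<gamma> \<notin> pos_roots}"
proof -
  obtain u where u: "u \<in> lists I" "word_prod W s u = w" using ex_word assms by blast
  have "finite {\<gamma> \<in> pos_roots. foldr reflect u \<gamma> \<notin> pos_roots}"
    using u(1)
  proof (induction u rule: rev_induct)
    case (snoc i u)
    let ?N = "{\<gamma> \<in> pos_roots. foldr reflect u \<gamma> \<notin> pos_roots}"
    have i: "i \<in> I" using snoc.prems by simp
    have "{\<gamma> \<in> pos_roots. foldr reflect (u @ [i]) \<gamma> \<notin> pos_roots} \<subseteq> insert (simple_root i) (reflect i ` ?N)"
    proof
      fix \<gamma> assume g: "\<gamma> \<in> {\<gamma> \<in> pos_roots. foldr reflect (u @ [i]) \<gamma> \<notin> pos_roots}"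
      show "\<gamma> \<in> insert (simple_root i) (reflect i ` ?N)"
      proof (cases "\<gamma> = simple_root i")
        case False
        then have "reflect i \<gamma> \<in> ?N" using g reflect_pos i by auto
        then show ?thesis using reflect_reflect[OF i, of \<gamma>] by force
      qed simp
    qed
    then show ?case using snoc by (auto intro: finite_subset)
  qed simp
  then show ?thesis using act_word[OF u(1)] u by simp
qed

text \<open>The reflection in v \<alpha>_i is the conjugate by v of a simple reflection.\<close>

lemma reflect_in_root: assumes "x \<in> roots" "\<beta> \<in> roots"
  shows "lin_comb 1 \<beta> (- 2 * bilin \<beta> x) x \<in> roots"
proof -
  obtain v i where v: "v \<in> carrier W" "i \<in> I" "x = act v (simple_root i)"
    using assms by (auto simp: roots_def)
  have "bilin (act (inv v) \<beta>) (simple_root i) = bilin \<beta> x"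
    using bilin_act[of v "act (inv v) \<beta>" "simple_root i"] v by simp
  then have "act v (reflect i (act (inv v) \<beta>)) = lin_comb 1 \<beta> (- 2 * bilin \<beta> x) x"
    using v by (simp add: reflect_eq act_lin_comb)
  moreover have "act v (reflect i (act (inv v) \<beta>)) \<in> roots"
    using v assms by (intro act_in_roots reflect_in_roots) auto
  ultimately show ?thesis by simp
qed

end

section \<open>Dominance and roots separating a point from a convex set\<close>

text \<open>This is U_{n-1}(b), with U the Chebyshev polynomials of the second kind. In contrast to
  \<open>cheb\<close>, b is any real number, because the form may take any value below -1 on two
  positive roots.\<close>

fun chebyshev :: "real \<Rightarrow> nat \<Rightarrow> real" where
  "chebyshev b 0 = 0"
| "chebyshev b (Suc 0) = 1"
| "chebyshev b (Suc (Suc n)) = 2 * b * chebyshev b (Suc n) - chebyshev b n"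

text \<open>For b \<ge> 1 the increments never decrease as long as the values are nonnegative, and
  the first increment is 1; hence both claims go through one induction.\<close>

lemma chebyshev_growth:
  assumes "1 \<le> b" shows "0 \<le> chebyshev b n \<and> chebyshev b n + 1 \<le> chebyshev b (Suc n)"
proof (induction n)
  case (Suc n)
  have "2 * chebyshev b (Suc n) \<le> 2 * b * chebyshev b (Suc n)"
    using Suc assms by (intro mult_right_mono) auto
  moreover have "chebyshev b (Suc (Suc n)) = 2 * b * chebyshev b (Suc n) - chebyshev b n" by simp
  ultimately show ?case using Suc by linarith
qed simp

lemma chebyshev_ge: "1 \<le> b \<Longrightarrow> real n \<le> chebyshev b n"
proof (induction n)
  case (Suc n)
  then show ?case using chebyshev_growth[of b n] by simp
qed simp

context coxeter_system
begin

text \<open>Otherwise \<open>w\<close> would invert every root that is a nonnegative combination of \<open>x\<close> and \<open>y\<close>, and the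
  infinite dihedral group generated by their reflections yields infinitely many of these.\<close>

lemma no_common_inversion:
  assumes x: "x \<in> pos_roots" and y: "y \<in> pos_roots" and xy: "bilin x y \<le> -1"
    and w: "w \<in> carrier W" "act w x \<notin> pos_roots" "act w y \<notin> pos_roots"
  shows False
proof -
  define b where "b = - bilin x y"
  define c where "c = chebyshev b"
  \<comment> \<open>Reflecting x alternately in y and in x produces consecutive coefficients
    \<open>c\<close>; every second root of this sequence is recorded.\<close>
  define z where "z n = lin_comb (c (Suc (2 * n))) x (c (2 * n)) y" for n
  have b: "1 \<le> b" using xy by (simp add: b_def)
  have bil: "bilin x y = - b" "bilin y x = - b" "bilin x x = 1" "bilin y y = 1"
    using x y bilin_root bilin_sym[of y x] by (auto simp: b_def pos_roots_iff)
  have c0: "0 \<le> c n" and cn: "real n \<le> c n" for n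
    using chebyshev_growth[OF b] chebyshev_ge[OF b] by (auto simp: c_def)
  have c_step: "c (Suc (Suc n)) = 2 * b * c (Suc n) - c n" for n by (simp add: c_def)
  have roots: "x \<in> roots" "y \<in> roots" using x y by (auto simp: pos_roots_iff)
  have z_root: "z n \<in> roots" for n
  proof (induction n)
    case 0
    show ?case using roots by (simp add: z_def c_def lin_comb_def)
  next
    case (Suc n)
    have 1: "lin_comb 1 (z n) (- 2 * bilin (z n) y) y = lin_comb (c (Suc (2 * n))) x (c (Suc (Suc (2 * n)))) y"
      by (simp add: z_def bilin_lin_comb_left bil c_step) (simp add: lin_comb_def algebra_simps)
    have "lin_comb (c (Suc (2 * n))) x (c (Suc (Suc (2 * n)))) y \<in> roots"
      using reflect_in_root[OF roots(2) Suc] unfolding 1 .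
    from reflect_in_root[OF roots(1) this]
    have "lin_comb (c (Suc (Suc (Suc (2 * n))))) x (c (Suc (Suc (2 * n)))) y \<in> roots"
      by (simp add: bilin_lin_comb_left bil c_step[of "Suc (2 * n)"])
         (simp add: lin_comb_def algebra_simps)
    then show ?case by (simp add: z_def)
  qed
  have neg_w: "nonneg (neg (act w x))" "nonneg (neg (act w y))"
    using w roots neg_in_pos_roots_iff act_in_roots by (auto simp: pos_roots_iff)
  have inv: "z n \<in> {\<gamma> \<in> pos_roots. act w \<gamma> \<notin> pos_roots}" for n
  proof -
    have p: "z n \<in> pos_roots"
      using z_root[of n] x y c0 by (auto simp: pos_roots_iff z_def nonneg_def lin_comb_def)
    have *: "c (Suc (2 * n)) * act w x k + c (2 * n) * act w y k \<le> 0" if "k \<in> I" for k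
      using that neg_w c0 by (intro add_nonpos_nonpos mult_nonneg_nonpos) (auto simp: nonneg_def neg_def)
    have "nonneg (neg (act w (z n)))"
      unfolding z_def act_lin_comb unfolding nonneg_def neg_def lin_comb_def
      by (auto simp only: neg_0_le_iff_le *)
    then have "neg (act w (z n)) \<in> pos_roots"
      using act_in_roots[OF w(1) z_root] neg_in_roots by (simp add: pos_roots_iff)
    then show ?thesis using p neg_in_pos_roots_iff act_in_roots[OF w(1) z_root] by auto
  qed
  \<comment> \<open>A coordinate in which x is positive grows at least linearly along
    \<open>z\<close>. Its unboundedness on a finite set of inversions is the contradiction and
    replaces a proof that the roots are distinct.\<close>
  obtain k where k: "k \<in> I" "0 < x k" "0 \<le> y k"
  proof -
    obtain k where "k \<in> I" "x k \<noteq> 0" using root_nonzero[OF roots(1)] by blast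
    moreover from this have "0 \<le> x k" "0 \<le> y k" using x y by (auto simp: pos_roots_def)
    ultimately show ?thesis using that by simp
  qed
  have "bdd_above ((\<lambda>\<gamma>. \<gamma> k) ` {\<gamma> \<in> pos_roots. act w \<gamma> \<notin> pos_roots})"
    using finite_inversions w by (intro bdd_above_finite finite_imageI) auto
  then obtain M where M: "\<And>n. z n k \<le> M"
    using inv unfolding bdd_above_def by blast
  obtain n where n: "M < real n * x k" using reals_Archimedean3 k by blast
  have "real n * x k \<le> c (Suc (2 * n)) * x k" using cn[of "Suc (2 * n)"] k by (intro mult_right_mono) auto
  also have "\<dots> \<le> z n k" using c0[of "2 * n"] k by (simp add: z_def lin_comb_def)
  finally show False using M[of n] n by linarith
qed

end

section \<open>Complete graphs and dihedral roots\<close>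

locale complete_coxeter_system = coxeter_system W I s
  for W :: "('w, 'b) monoid_scheme" (structure) and I :: "'i set" and s :: "'i \<Rightarrow> 'w" +
  assumes complete: complete_graph
begin

lemma m_complete: "x \<in> I \<Longrightarrow> y \<in> I \<Longrightarrow> x \<noteq> y \<Longrightarrow> m x y = 0 \<or> 3 \<le> m x y"
  using complete by (simp add: complete_graph_def graph_edge_def)

lemma gram_le: assumes "x \<in> I" "y \<in> I" "x \<noteq> y" shows "gram x y \<le> - 1 / 2"
proof (cases "m x y = 0")
  case False
  then have "3 \<le> m x y" using m_complete[OF assms] by simp
  then have "pi / real (m x y) \<le> pi / 3" by (intro divide_left_mono) auto
  then have "cos (pi / 3) \<le> cos (pi / real (m x y))" by (intro cos_monotone_0_pi_le) auto
  then show ?thesis using False by (simp add: gram_def cos_60)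
qed (simp add: gram_def)

text \<open>Both coefficients are at least 1 and both Gram entries at most -1/2, so each of the two
  summands contributes at most -1/2.\<close>

lemma bilin_dih_le:
  assumes "x \<in> I" "y \<in> I" "j \<in> I" "j \<notin> {x, y}" "0 < k" "Suc k < m x y"
  shows "bilin (dih x y k) (simple_root j) \<le> -1"
proof -
  have "1 \<le> cheb (m x y) k" "1 \<le> cheb (m x y) (Suc k)" using assms by (auto intro!: cheb_ge_1)
  moreover have "gram x j \<le> - 1 / 2" "gram y j \<le> - 1 / 2" using gram_le assms by auto
  ultimately have "1 * (1 / 2) \<le> cheb (m x y) k * - gram x j"
    "1 * (1 / 2) \<le> cheb (m x y) (Suc k) * - gram y j"
    by - (rule mult_mono; linarith)+
  then show ?thesis using assms by (simp add: dih_def bilin_lin_comb_left bilin_simple)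
qed

text \<open>The bounds on k leave out the ends k = 0 and k = m(x,y) - 1, which are the simple roots
  of y and x. For the label infinity, encoded by 0, they cannot be met.\<close>

definition good :: "('i \<Rightarrow> real) \<Rightarrow> bool" where
  "good \<rho> \<longleftrightarrow> (\<exists>x\<in>I. \<rho> = simple_root x) \<or>
     (\<exists>x\<in>I. \<exists>y\<in>I. \<exists>k. x \<noteq> y \<and> 0 < k \<and> Suc k < m x y \<and> \<rho> = dih x y k)"

lemma good_simple: "x \<in> I \<Longrightarrow> good (simple_root x)"
  by (auto simp: good_def)

lemma good_dih:
  assumes "x \<in> I" "y \<in> I" "x \<noteq> y" "k < m x y" shows "good (dih x y k)"
proof -
  consider "k = 0" | "0 < k" "Suc k < m x y" | "Suc k = m x y" using assms by linarith
  then show ?thesis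
  proof cases
    case 1 then show ?thesis using assms by (simp add: dih_0 good_simple)
  next
    case 2
    show ?thesis unfolding good_def
      by (intro disjI2 bexI[of _ x] bexI[of _ y] exI[of _ k] conjI refl) (use assms 2 in auto)
  next
    case 3
    have "dih x y k = dih y x (m x y - Suc k)" using assms by (intro dih_reverse) auto
    then have "dih x y k = dih y x 0" by (simp only: 3 diff_self_eq_0)
    then show ?thesis using assms by (simp add: dih_0 good_simple)
  qed
qed

lemma good_nonneg: "good \<rho> \<Longrightarrow> nonneg \<rho>"
proof -
  assume "good \<rho>"
  then consider x where "\<rho> = simple_root x"
    | x y k where "x \<in> I" "y \<in> I" "x \<noteq> y" "Suc k < m x y" "\<rho> = dih x y k"
    by (auto simp: good_def)
  then show ?thesis
  proof cases
    case 2
    then show ?thesis unfolding 2(5) dih_def by (intro dih_nonneg) simp_all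
  qed simp
qed

end

section \<open>Roots bounding a point relative to a convex set\<close>

locale complete_coxeter_convex = complete_coxeter_system W I s
  for W :: "('w, 'b) monoid_scheme" (structure) and I :: "'i set" and s :: "'i \<Rightarrow> 'w" +
  fixes L :: "'w set"
  assumes convex: "convex_subset L" and nonempty: "L \<noteq> {}"
begin

text \<open>Roots are transported by \<open>u\<close>, so that a toggle by \<open>i\<close> fixes \<open>u\<close> iff \<open>u\<close> is bounded by the simple
  root of \<open>i\<close>, and \<open>bounds u (neg \<rho>)\<close> with \<open>\<rho>\<close> positive means that \<open>\<rho>\<close> separates \<open>u\<close> from \<open>L\<close>.\<close>

definition bounds :: "'w \<Rightarrow> ('i \<Rightarrow> real) \<Rightarrow> bool" where
  "bounds u \<gamma> \<longleftrightarrow> act (inv u) \<gamma> \<in> containing_roots L"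

lemma L_carrier: "L \<subseteq> carrier W"
  using convex by (auto simp: convex_subset_def)

lemma bounds_iff:
  assumes u: "u \<in> carrier W"
  shows "bounds u \<gamma> \<longleftrightarrow> \<gamma> \<in> roots \<and> (\<forall>v\<in>L. act (v \<otimes> inv u) \<gamma> \<in> pos_roots)"
proof -
  have "act (inv u) \<gamma> \<in> roots \<longleftrightarrow> \<gamma> \<in> roots"
    using act_in_roots[of u "act (inv u) \<gamma>"] act_in_roots[of "inv u" \<gamma>] u by auto
  moreover have "v \<in> half_space (act (inv u) \<gamma>) \<longleftrightarrow> act (v \<otimes> inv u) \<gamma> \<in> pos_roots" if "v \<in> L" for v
    using that L_carrier u by (auto simp: half_space_def act_mult)
  ultimately show ?thesis by (auto simp: bounds_def containing_roots_def)
qed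

lemma bounds_comb:
  assumes "u \<in> carrier W" "bounds u \<gamma>" "bounds u \<delta>" "lin_comb a \<gamma> b \<delta> \<in> roots" "0 \<le> a" "0 \<le> b"
  shows "bounds u (lin_comb a \<gamma> b \<delta>)"
proof -
  have "act (v \<otimes> inv u) (lin_comb a \<gamma> b \<delta>) \<in> pos_roots" if "v \<in> L" for v
  proof -
    have "act (v \<otimes> inv u) (lin_comb a \<gamma> b \<delta>) \<in> roots"
      using assms that L_carrier by (intro act_in_roots) auto
    moreover have "nonneg (act (v \<otimes> inv u) \<gamma>)" "nonneg (act (v \<otimes> inv u) \<delta>)"
      using assms that by (auto simp: bounds_iff pos_roots_iff)
    ultimately show ?thesis using assms(5,6) unfolding act_lin_comb
      by (auto simp: pos_roots_iff nonneg_def lin_comb_def)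
  qed
  then show ?thesis using assms by (simp add: bounds_iff)
qed

lemma bounds_not_neg: assumes "u \<in> carrier W" "bounds u \<gamma>" shows "\<not> bounds u (neg \<gamma>)"
proof -
  obtain v where v: "v \<in> L" using nonempty by blast
  have "act (v \<otimes> inv u) \<gamma> \<in> pos_roots" "act (v \<otimes> inv u) \<gamma> \<in> roots" 
    using assms v by (auto simp: bounds_iff pos_roots_iff)
  then have "act (v \<otimes> inv u) (neg \<gamma>) \<notin> pos_roots"
    using neg_in_pos_roots_iff by (simp add: act_neg)
  then show ?thesis using v assms by (auto simp: bounds_iff)
qed

lemma bounds_gen: assumes "u \<in> carrier W" "i \<in> I"
  shows "bounds (s i \<otimes> u) (reflect i \<gamma>) \<longleftrightarrow> bounds u \<gamma>"
  using assms by (simp add: bounds_def inv_mult_group gen_inv act_mult act_gen reflect_reflect)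

lemma reflect_neg: "reflect i (neg \<gamma>) = neg (reflect i \<gamma>)"
  by (simp add: neg_eq_lin_comb reflect_lin_comb)

lemma bounds_gen_neg: "u \<in> carrier W \<Longrightarrow> i \<in> I \<Longrightarrow>
    bounds (s i \<otimes> u) (neg (reflect i \<gamma>)) \<longleftrightarrow> bounds u (neg \<gamma>)"
  using bounds_gen[of u i "neg \<gamma>"] by (simp add: reflect_neg)

text \<open>For v in L the element v u^-1 inverts \<rho>, so by \<open>no_common_inversion\<close>
  it cannot invert \<alpha>_x as well. In consequence the toggle by x fixes u.\<close>

lemma bounds_dominated:
  assumes u: "u \<in> carrier W" and b: "bounds u (neg \<rho>)" and "nonneg \<rho>" and x: "x \<in> I"
    and le: "bilin \<rho> (simple_root x) \<le> -1"
  shows "bounds u (simple_root x)"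
proof -
  have root: "\<rho> \<in> roots" using b u neg_in_roots[of "neg \<rho>"] by (simp add: bounds_iff)
  have "act (v \<otimes> inv u) (simple_root x) \<in> pos_roots" if v: "v \<in> L" for v
  proof (rule ccontr)
    have c: "v \<otimes> inv u \<in> carrier W" using v L_carrier u by auto
    have "act (v \<otimes> inv u) (neg \<rho>) \<in> pos_roots" using b u v by (simp add: bounds_iff)
    then have "act (v \<otimes> inv u) \<rho> \<notin> pos_roots"
      using neg_in_pos_roots_iff[OF act_in_roots[OF c root]] by (simp add: act_neg)
    moreover assume "act (v \<otimes> inv u) (simple_root x) \<notin> pos_roots"
    ultimately show False
      using no_common_inversion[OF _ simple_in_pos_roots[OF x] le c] root \<open>nonneg \<rho>\<close>
      by (simp add: pos_roots_iff)
  qed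
  then show ?thesis using u x by (simp add: bounds_iff simple_in_roots)
qed

lemma toggle_eq:
  "toggle L i u = (if bounds u (simple_root i) then u else s i \<otimes> u)"
  by (simp add: toggle_def bounds_def)

lemma ex_bounds_outside:
  assumes u: "u \<in> carrier W" "u \<notin> L" shows "\<exists>\<gamma>\<in>pos_roots. bounds u (neg \<gamma>)"
proof -
  obtain F where F: "F \<subseteq> roots" "L = carrier W \<inter> (\<Inter>\<beta>\<in>F. half_space \<beta>)"
    using convex by (auto simp: convex_subset_def)
  then obtain \<beta> where \<beta>: "\<beta> \<in> F" "u \<notin> half_space \<beta>" using u by auto
  then have "\<beta> \<in> roots" "\<beta> \<in> containing_roots L" using F by (auto simp: containing_roots_def)
  then have "bounds u (act u \<beta>)" "neg (act u \<beta>) \<in> pos_roots"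
    using \<beta> u neg_in_pos_roots_iff act_in_roots by (auto simp: bounds_def half_space_def)
  then show ?thesis by (intro bexI[of _ "neg (act u \<beta>)"]) simp_all
qed

lemma bounds_pos: "u \<in> L \<Longrightarrow> bounds u \<gamma> \<Longrightarrow> \<gamma> \<in> pos_roots"
  using L_carrier by (force simp: bounds_iff)

text \<open>If the form value is at most -1, then \<alpha>_i bounds u and turns into a separating
  root of s_i u. Otherwise i belongs to the dihedral system of \<rho>, or \<rho> is simple and its
  label with i is finite, and the reflected root is again of the required kind.\<close>

lemma good_step:
  assumes u: "u \<in> carrier W" and i: "i \<in> I" and \<rho>: "good \<rho>" "bounds u (neg \<rho>)" "\<rho> \<noteq> simple_root i"
  shows "\<exists>\<rho>'. good \<rho>' \<and> bounds (s i \<otimes> u) (neg \<rho>')"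
proof (cases "bilin \<rho> (simple_root i) \<le> -1")
  case True
  then have "bounds u (simple_root i)" using bounds_dominated u i \<rho> good_nonneg by blast
  then have "bounds (s i \<otimes> u) (neg (simple_root i))"
    using bounds_gen[OF u i, of "simple_root i"] i by (simp add: reflect_simple)
  then show ?thesis using good_simple i by blast
next
  case False
  have "good (reflect i \<rho>)"
  proof -
    consider x where "x \<in> I" "\<rho> = simple_root x"
      | x y k where "x \<in> I" "y \<in> I" "x \<noteq> y" "0 < k" "Suc k < m x y" "\<rho> = dih x y k"
      using \<rho>(1) by (auto simp: good_def)
    then show ?thesis
    proof cases
      case 1
      then have xi: "x \<noteq> i" using \<rho>(3) by auto
      have "m x i \<noteq> 0" using False 1 i by (auto simp: bilin_simple gram_def split: if_splits)
      then have "m i x \<noteq> 0" using 1 i m_sym[of x i] by simp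
      then have "3 \<le> m i x" using m_complete[of i x] xi 1 i by simp
      then have "Suc 0 < m x i" using m_sym[of x i] 1 i by simp
      moreover have "reflect i \<rho> = dih x i (Suc 0)"
        using reflect_dih[of i x 0] xi 1 i by (simp add: dih_0)
      ultimately show ?thesis using good_dih[of x i "Suc 0"] xi 1 i by simp
    next
      case 2
      then have "i = x \<or> i = y" using bilin_dih_le[of x y i k] False i by auto
      then show ?thesis
      proof
        assume "i = x"
        then show ?thesis using reflect_dih[of x y k] good_dih[of y x "Suc k"] 2 m_sym[of x y] by simp
      next
        assume "i = y"
        moreover obtain l where "k = Suc l" using 2 by (cases k) auto
        ultimately show ?thesis
          using reflect_dih_Suc[of x y l] good_dih[of y x l] 2 m_sym[of x y] by simp
      qed
    qed
  qed
  then show ?thesis using bounds_gen_neg u i \<rho> by blast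
qed

text \<open>Induction on the distance to a fixed v in L, stepping from u towards v across the wall
  of some \<alpha>_i. If the neighbour lies in L, this is the only root whose side changes, so
  \<alpha>_i separates; if not, a root found for the neighbour is carried back by
  \<open>good_step\<close>.\<close>

lemma ex_good_outside:
  assumes "u \<in> carrier W" "u \<notin> L" shows "\<exists>\<rho>. good \<rho> \<and> bounds u (neg \<rho>)"
proof -
  obtain v where v: "v \<in> L" "v \<in> carrier W" using nonempty L_carrier by blast
  show ?thesis
    using assms
  proof (induction "len (v \<otimes> inv u)" arbitrary: u rule: less_induct)
    case less
    note u = less.prems(1)
    define w where "w = v \<otimes> inv u"
    have w: "w \<in> carrier W" using u v by (simp add: w_def)
    obtain z where z: "z \<in> lists I" "length z = len w" "word_prod W s z = w"
      using ex_reduced w by blast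
    have "z \<noteq> []"
    proof
      assume "z = []"
      then have "v \<otimes> inv u = \<one>" using z by (simp add: w_def)
      then have "v = u" using u v by (metis inv_equality inv_inv inv_closed)
      then show False using v less.prems by simp
    qed
    then obtain z' i where zi: "z = z' @ [i]" by (cases z rule: rev_cases) auto
    then have i: "i \<in> I" "z' \<in> lists I" using z by auto
    have "w \<otimes> s i = word_prod W s z'"
      using z zi i gen_cancel_right[OF i(1) word_prod_closed[OF i(2)]] by (auto simp: word_prod_append)
    then have lt: "len (w \<otimes> s i) < len w" using len_le[of z'] i z zi by simp
    have "act w (simple_root i) \<notin> pos_roots" using act_simple_neg w i lt by blast
    then have nb: "\<not> bounds u (simple_root i)" using v u by (auto simp: bounds_iff w_def)
    define u' where "u' = s i \<otimes> u"
    have u': "u' \<in> carrier W" "u = s i \<otimes> u'" using u i by (auto simp: u'_def gen_cancel)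
    have "v \<otimes> inv u' = w \<otimes> s i"
      using u v i by (simp add: u'_def w_def inv_mult_group gen_inv m_assoc)
    then have lt': "len (v \<otimes> inv u') < len (v \<otimes> inv u)" using lt by (simp add: w_def)
    show ?case
    proof (cases "u' \<in> L")
      case True
      obtain \<gamma> where g: "\<gamma> \<in> pos_roots" "bounds u (neg \<gamma>)" using ex_bounds_outside less.prems by blast
      then have "neg (reflect i \<gamma>) \<in> pos_roots"
        using bounds_pos[OF True] bounds_gen_neg[OF u i(1)] by (simp add: u'_def)
      then have "reflect i \<gamma> \<notin> pos_roots"
        using neg_in_pos_roots_iff[of "reflect i \<gamma>"] reflect_in_roots i g by (simp add: pos_roots_iff)
      then have "\<gamma> = simple_root i" using reflect_pos g i by blast
      then show ?thesis using g good_simple i by blast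
    next
      case False
      then obtain \<rho> where \<rho>: "good \<rho>" "bounds u' (neg \<rho>)" using less.hyps[OF lt' u'(1)] by blast
      \<comment> \<open>Equality would make \<alpha>_i bound u, although v lies on the other side of
        that wall.\<close>
      have "\<rho> \<noteq> simple_root i"
      proof
        assume "\<rho> = simple_root i"
        then have "bounds u' (reflect i (simple_root i))" using \<rho> i by (simp add: reflect_simple)
        then show False using nb bounds_gen[OF u i(1)] by (simp add: u'_def)
      qed
      then show ?thesis using good_step[OF u'(1) i(1) \<rho>] u' by simp
    qed
  qed
qed

end

section \<open>Periodic orbits\<close>

locale complete_coxeter_orbit = complete_coxeter_convex W I s L
  for W :: "('w, 'b) monoid_scheme" (structure) and I :: "'i set" and s :: "'i \<Rightarrow> 'w" and L :: "'w set" +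
  fixes xs :: "'i list" and start :: 'w and K :: nat
  assumes ordering: "index_ordering xs" and I_nonempty: "I \<noteq> {}"
    and start: "start \<in> carrier W" and K: "1 \<le> K" and periodic: "(Pro L xs ^^ K) start = start"
begin

definition letter :: "nat \<Rightarrow> 'i" where
  "letter t = xs ! (t mod length xs)"

definition orb :: "nat \<Rightarrow> 'w" where
  "orb t = fold (toggle L) (map letter [0..<t]) start"

definition before :: "nat \<Rightarrow> 'i \<Rightarrow> 'i \<Rightarrow> bool" where
  "before t x y \<longleftrightarrow> (\<exists>p\<ge>t. letter p = x \<and> (\<forall>q\<in>{t..p}. letter q \<noteq> y))"

lemma length_pos: "0 < length xs"
  using ordering I_nonempty by (auto simp: index_ordering_def)

lemma letter_in [simp]: "letter t \<in> I"
  using ordering length_pos by (auto simp: letter_def index_ordering_def)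

lemma letter_periodic: "letter (t + k * length xs) = letter t"
  by (simp add: letter_def)

lemma letter_eq_iff: "letter p = letter q \<longleftrightarrow> p mod length xs = q mod length xs"
  using ordering length_pos by (simp add: letter_def index_ordering_def nth_eq_iff_index_eq)

lemma ex_letter: assumes "x \<in> I" shows "\<exists>p\<ge>t. letter p = x"
proof -
  obtain i where i: "i < length xs" "xs ! i = x"
    using assms ordering by (metis index_ordering_def in_set_conv_nth)
  have "t * 1 \<le> t * length xs" using length_pos by (intro mult_le_mono2) (simp add: Suc_le_eq)
  then have "t \<le> i + t * length xs" unfolding mult_1_right by (rule trans_le_add2)
  then show ?thesis using i by (intro exI[of _ "i + t * length xs"]) (simp add: letter_periodic letter_def)
qed

lemma first_letter: assumes "x \<in> I"
  obtains p where "t \<le> p" "letter p = x" "\<And>q. t \<le> q \<Longrightarrow> q < p \<Longrightarrow> letter q \<noteq> x"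
proof -
  define p where "p = (LEAST p. t \<le> p \<and> letter p = x)"
  have "t \<le> p \<and> letter p = x"
    unfolding p_def by (rule LeastI_ex) (use ex_letter[OF assms, of t] in auto)
  moreover have "letter q \<noteq> x" if "t \<le> q" "q < p" for q
    using that not_less_Least[of q "\<lambda>p. t \<le> p \<and> letter p = x"] by (auto simp: p_def)
  ultimately show ?thesis using that by blast
qed

lemma before_total: assumes "x \<in> I" "y \<in> I" "x \<noteq> y" shows "before t x y \<or> before t y x"
proof -
  obtain p where p: "t \<le> p" "letter p = x" "\<And>q. t \<le> q \<Longrightarrow> q < p \<Longrightarrow> letter q \<noteq> x"
    using first_letter assms by metis
  obtain p' where p': "t \<le> p'" "letter p' = y" "\<And>q. t \<le> q \<Longrightarrow> q < p' \<Longrightarrow> letter q \<noteq> y"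
    using first_letter assms by metis
  show ?thesis
  proof (cases "p < p'")
    case True
    then have "before t x y" unfolding before_def using p p' by (intro exI[of _ p]) auto
    then show ?thesis ..
  next
    case False
    then have "before t y x" unfolding before_def using p p' assms
      by (intro exI[of _ p']) (auto simp: order.strict_iff_order)
    then show ?thesis ..
  qed
qed

lemma before_ne: "before t x y \<Longrightarrow> letter t \<noteq> y"
  by (auto simp: before_def)

lemma before_Suc: assumes "before t x y" "letter t \<noteq> x" shows "before (Suc t) x y"
proof -
  obtain p where p: "t \<le> p" "letter p = x" "\<forall>q\<in>{t..p}. letter q \<noteq> y"
    using assms by (auto simp: before_def)
  moreover have "t \<noteq> p" using p assms by auto
  ultimately show ?thesis unfolding before_def by (intro exI[of _ p]) auto
qed

text \<open>Each letter occurs once in any \<open>length xs\<close> consecutive steps: y recurs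
  before a full round has passed, x only when it is complete.\<close>

lemma before_Suc_swap: assumes "x \<in> I" "y \<in> I" "x \<noteq> y" "letter t = x" shows "before (Suc t) y x"
proof -
  let ?n = "length xs"
  obtain p where p: "Suc t \<le> p" "letter p = y" "\<And>q. Suc t \<le> q \<Longrightarrow> q < p \<Longrightarrow> letter q \<noteq> y"
    using first_letter assms by metis
  have "p < t + ?n"
  proof (rule ccontr)
    assume ge: "\<not> p < t + ?n"
    then have "letter (p - ?n) = y" using letter_periodic[of "p - ?n" 1] p by simp
    moreover from this have "p - ?n \<noteq> t" using assms by auto
    then have "Suc t \<le> p - ?n" "p - ?n < p" using ge length_pos p by linarith+
    ultimately show False using p(3) by blast
  qed
  have "letter q \<noteq> x" if "q \<in> {Suc t..p}" for q
  proof
    assume "letter q = x"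
    then have "q mod ?n = t mod ?n" using assms letter_eq_iff by metis
    then have "?n dvd q - t" using that by (simp add: mod_eq_dvd_iff_nat)
    then show False using that \<open>p < t + ?n\<close> by (auto dest: dvd_imp_le)
  qed
  then show ?thesis unfolding before_def using p by blast
qed

lemma orb_0 [simp]: "orb 0 = start"
  by (simp add: orb_def)

lemma orb_Suc: "orb (Suc t) = toggle L (letter t) (orb t)"
  by (simp add: orb_def)

lemma orb_carrier [simp]: "orb t \<in> carrier W"
  by (induction t) (simp_all add: start orb_Suc toggle_eq)

lemma orb_Pro: "orb (k * length xs) = (Pro L xs ^^ k) start"
proof (induction k)
  case (Suc k)
  have "map letter [k * length xs..<k * length xs + length xs] = xs"
    by (rule nth_equalityI) (simp_all add: letter_def)
  moreover have "[0..<Suc k * length xs] = [0..<k * length xs] @ [k * length xs..<k * length xs + length xs]"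
    using upt_add_eq_append[OF le0, of "k * length xs" "length xs"]
    by (simp only: mult_Suc add.commute[of "length xs"])
  ultimately have "orb (Suc k * length xs) = fold (toggle L) xs (orb (k * length xs))"
    by (simp add: orb_def)
  then show ?case using Suc by (simp add: Pro_def)
qed simp

definition period :: nat where
  "period = K * length xs"

lemma period_pos: "0 < period"
  using K length_pos by (simp add: period_def)

lemma orb_periodic: "orb (t + period) = orb t"
proof (induction t)
  case 0
  show ?case using orb_Pro[of K] periodic by (simp add: period_def)
next
  case (Suc t)
  then show ?case using letter_periodic[of t K] by (simp add: orb_Suc period_def)
qed

text \<open>The half-spaces containing \<open>L\<close> but not the current point can only be lost along the
  orbit, so periodicity forces them to stay the same.\<close>

lemma no_entering: "\<not> bounds (orb t) (neg (simple_root (letter t)))"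
proof
  define Sep where "Sep t = {\<beta> \<in> containing_roots L. act (orb t) \<beta> \<notin> pos_roots}" for t
  have mono1: "Sep (Suc t) \<subseteq> Sep t" for t
  proof
    fix \<beta> assume b: "\<beta> \<in> Sep (Suc t)"
    then have root: "\<beta> \<in> roots" by (simp add: Sep_def containing_roots_def)
    have "act (orb t) \<beta> \<notin> pos_roots"
    proof
      assume pos: "act (orb t) \<beta> \<in> pos_roots"
      then have ne: "orb (Suc t) \<noteq> orb t" using b by (auto simp: Sep_def)
      then have cross: "\<not> bounds (orb t) (simple_root (letter t))"
        and eq: "orb (Suc t) = s (letter t) \<otimes> orb t"
        by (auto simp: orb_Suc toggle_eq)
      have "reflect (letter t) (act (orb t) \<beta>) \<notin> pos_roots"
        using b by (simp add: Sep_def eq act_mult act_gen)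
      \<comment> \<open>A crossing changes the sign of a single positive root, its own simple root.
        That root cannot be the image of \<open>\<beta>\<close>: it would bound the current point,
        and the toggle would not move it.\<close>
      then have "act (orb t) \<beta> = simple_root (letter t)" using reflect_pos pos letter_in by blast
      then have "act (inv (orb t)) (simple_root (letter t)) = \<beta>"
        by (metis act_inv_left orb_carrier)
      then show False using cross b by (simp add: bounds_def Sep_def)
    qed
    then show "\<beta> \<in> Sep t" using b by (simp add: Sep_def)
  qed
  have mono: "Sep (t + k) \<subseteq> Sep t" for t k
    by (induction k) (use mono1 in auto)
  have "Sep (t + period) = Sep t" by (simp add: Sep_def orb_periodic)
  moreover have "Sep (t + period) \<subseteq> Sep (Suc t)"
    using mono[of "Suc t" "period - 1"] period_pos by simp
  ultimately have le: "Sep t \<subseteq> Sep (Suc t)" by simp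
  assume ent: "bounds (orb t) (neg (simple_root (letter t)))"
  define \<beta> where "\<beta> = act (inv (orb t)) (neg (simple_root (letter t)))"
  have b: "act (orb t) \<beta> = neg (simple_root (letter t))" by (simp add: \<beta>_def)
  have "\<beta> \<in> Sep t" using ent simple_in_pos_roots[of "letter t"] neg_in_pos_roots_iff[of "simple_root (letter t)"]
    by (simp add: Sep_def b) (simp add: \<beta>_def bounds_def simple_in_roots)
  \<comment> \<open>A root and its negative cannot both bound, as L is nonempty. So the toggle does
    cross, and \<open>\<beta>\<close> is lost from \<open>Sep\<close> for good.\<close>
  moreover have "\<not> bounds (orb t) (simple_root (letter t))"
    using ent bounds_not_neg by auto
  then have "act (orb (Suc t)) \<beta> = simple_root (letter t)"
    by (simp add: orb_Suc toggle_eq act_mult act_gen b reflect_neg reflect_simple)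
  then have "\<beta> \<notin> Sep (Suc t)" by (simp add: Sep_def simple_in_pos_roots)
  ultimately show False using le by blast
qed

lemma orb_bounce: "bounds (orb t) (simple_root (letter t)) \<Longrightarrow> orb (Suc t) = orb t"
  by (simp add: orb_Suc toggle_eq)

lemma orb_cross: "\<not> bounds (orb t) (simple_root (letter t)) \<Longrightarrow> orb (Suc t) = s (letter t) \<otimes> orb t"
  by (simp add: orb_Suc toggle_eq)

lemma orb_constant:
  assumes "t \<le> p" "\<And>q. t \<le> q \<Longrightarrow> q < p \<Longrightarrow> bounds (orb t) (simple_root (letter q))"
  shows "orb p = orb t"
  using assms
proof (induction p)
  case (Suc p)
  show ?case
  proof (cases "t = Suc p")
    case False
    then have "orb p = orb t" using Suc by auto
    then show ?thesis using orb_bounce[of p] Suc.prems(2)[of p] Suc.prems(1) False by simp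
  qed simp
qed simp

text \<open>If all letters bounced until x is due, the point would still be in place and \<alpha>_x
  would meet its own toggle, against \<open>no_entering\<close>.\<close>

lemma ex_crossing:
  assumes x: "x \<in> I" and b: "bounds (orb t) (neg (simple_root x))"
  shows "\<exists>p\<ge>t. orb p = orb t \<and> letter p \<noteq> x \<and> \<not> bounds (orb t) (simple_root (letter p))"
proof (rule ccontr)
  assume no: "\<not> ?thesis"
  obtain p where p: "t \<le> p" "letter p = x" "\<And>q. t \<le> q \<Longrightarrow> q < p \<Longrightarrow> letter q \<noteq> x"
    using first_letter x by metis
  have "orb q = orb t" if "t \<le> q" "q \<le> p" for q
    using that
  proof (induction q)
    case (Suc q)
    show ?case
    proof (cases "t = Suc q")
      case False
      then have "orb q = orb t" "t \<le> q" using Suc by auto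
      then show ?thesis using orb_bounce[of q] no p(3)[of q] Suc.prems by auto
    qed simp
  qed simp
  then have "orb p = orb t" using p by blast
  then show False using no_entering[of p] b p by simp
qed

lemma dih_others_bounce:
  assumes "x \<in> I" "y \<in> I" "x \<noteq> y" "0 < k" "Suc k < m x y" "bounds (orb t) (neg (dih x y k))"
    "j \<in> I" "j \<notin> {x, y}"
  shows "bounds (orb t) (simple_root j)"
proof (rule bounds_dominated)
  show "bilin (dih x y k) (simple_root j) \<le> - 1" using bilin_dih_le assms by blast
  show "nonneg (dih x y k)" unfolding dih_def using assms by (intro dih_nonneg) simp_all
qed (use assms in auto)

text \<open>If \<alpha>_x bounded the point, so would -\<alpha>_y, being a nonnegative combination
  of \<alpha>_x and the negative of the dihedral root. Then \<alpha>_y separates and some letter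
  other than y crosses; but x and all letters outside the pair bounce.\<close>

lemma dih_crosses:
  assumes x: "x \<in> I" "y \<in> I" "x \<noteq> y" and k: "0 < k" "Suc k < m x y"
    and b: "bounds (orb t) (neg (dih x y k))"
  shows "\<not> bounds (orb t) (simple_root x)"
proof
  assume bx: "bounds (orb t) (simple_root x)"
  have c: "1 \<le> cheb (m x y) k" "1 \<le> cheb (m x y) (Suc k)" using k by (auto intro!: cheb_ge_1)
  let ?a = "1 / cheb (m x y) (Suc k)" and ?b = "cheb (m x y) k / cheb (m x y) (Suc k)"
  have eq: "lin_comb ?a (neg (dih x y k)) ?b (simple_root x) = neg (simple_root y)"
    using c by (simp add: dih_def lin_comb_def neg_def fun_eq_iff field_simps)
  have "bounds (orb t) (neg (simple_root y))"
    using bounds_comb[OF orb_carrier b bx, of ?a ?b] c x unfolding eq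
    by (simp add: neg_in_roots simple_in_roots)
  then obtain p where "letter p \<noteq> y" "\<not> bounds (orb t) (simple_root (letter p))"
    using ex_crossing x by blast
  then show False using bx dih_others_bounce[OF x k b, of "letter p"] by (cases "letter p = x") auto
qed

text \<open>The pullback of a functional that is positive on simple roots: a negative value on some simple
  root certifies \<open>u \<noteq> b\<close>.\<close>

definition height :: "'w \<Rightarrow> 'w \<Rightarrow> ('i \<Rightarrow> real) \<Rightarrow> real" where
  "height b u \<gamma> = (\<Sum>k\<in>I. act (b \<otimes> inv u) \<gamma> k)"

lemma height_lin_comb: "height b u (lin_comb p \<beta> q \<gamma>) = p * height b u \<beta> + q * height b u \<gamma>"
  unfolding height_def act_lin_comb by (simp add: lin_comb_def sum.distrib sum_distrib_left)

lemma height_gen: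
  assumes "b \<in> carrier W" "u \<in> carrier W" "i \<in> I"
  shows "height b (s i \<otimes> u) \<gamma> = height b u (reflect i \<gamma>)"
  using assms by (simp add: height_def inv_mult_group gen_inv act_mult act_gen)

lemma height_base: "u \<in> carrier W \<Longrightarrow> x \<in> I \<Longrightarrow> height u u (simple_root x) = 1"
  using finite_index by (simp add: height_def simple_root_def)

lemma height_gen_simple:
  assumes "b \<in> carrier W" "u \<in> carrier W" "i \<in> I" "j \<in> I"
  shows "height b (s i \<otimes> u) (simple_root j)
    = height b u (simple_root j) - 2 * gram j i * height b u (simple_root i)"
  using assms unfolding height_gen[OF assms(1-3)] reflect_eq height_lin_comb
  by (simp add: bilin_simple)

lemma height_gen_self:
  assumes "b \<in> carrier W" "u \<in> carrier W" "i \<in> I"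
  shows "height b (s i \<otimes> u) (simple_root i) = - height b u (simple_root i)"
  using height_gen_simple[of b u i i] assms gram_self by simp

text \<open>Completeness in the form -2 B(\<alpha>_j, \<alpha>_i) \<ge> 1: a crossing at a letter of
  nonnegative height raises every other simple height by at least that much.\<close>

lemma height_gen_other:
  assumes "b \<in> carrier W" "u \<in> carrier W" "i \<in> I" "j \<in> I" "i \<noteq> j" "0 \<le> height b u (simple_root i)"
  shows "height b u (simple_root j) + height b u (simple_root i) \<le> height b (s i \<otimes> u) (simple_root j)"
proof -
  have "1 * height b u (simple_root i) \<le> (- 2 * gram j i) * height b u (simple_root i)"
    using gram_le[of j i] assms by (intro mult_right_mono) auto
  then show ?thesis using height_gen_simple[of b u i j] assms by simp
qed

text \<open>In both states below \<open>y\<close> is the letter crossed last. The separating root stays simple until some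
  other letter is crossed, then runs through a dihedral root system until it is simple again.\<close>

definition simple_state :: "'w \<Rightarrow> nat \<Rightarrow> 'i \<Rightarrow> 'i \<Rightarrow> bool" where
  "simple_state b t x y \<longleftrightarrow> x \<in> I \<and> y \<in> I \<and> x \<noteq> y \<and> before t x y \<and>
     bounds (orb t) (neg (simple_root x)) \<and>
     0 < height b (orb t) (simple_root x) \<and> height b (orb t) (simple_root y) < 0 \<and>
     (\<forall>j\<in>I - {x, y}. 0 < height b (orb t) (simple_root j) \<and>
        0 < height b (orb t) (simple_root j) + height b (orb t) (simple_root y))"

definition dih_state :: "'w \<Rightarrow> nat \<Rightarrow> 'i \<Rightarrow> 'i \<Rightarrow> nat \<Rightarrow> bool" where
  "dih_state b t x y k \<longleftrightarrow> x \<in> I \<and> y \<in> I \<and> x \<noteq> y \<and> before t x y \<and>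
     0 < k \<and> Suc k < m x y \<and> bounds (orb t) (neg (dih x y k)) \<and>
     0 < height b (orb t) (simple_root x) \<and> height b (orb t) (simple_root y) < 0 \<and>
     (\<forall>j\<in>I - {x, y}. 0 < height b (orb t) (simple_root j)) \<and>
     0 < height b (orb t) (dih x y k)"

definition state :: "'w \<Rightarrow> nat \<Rightarrow> bool" where
  "state b t \<longleftrightarrow> (\<exists>x y. simple_state b t x y \<or> (\<exists>k. dih_state b t x y k))"

section \<open>Persistence of the sign pattern\<close>

text \<open>An infinite label between x and i would give the form value -1, and i would bounce; so
  the reflected root is an interior root of a finite dihedral system. By
  \<open>height_gen_other\<close> the hypothesis \<open>hj\<close> makes every third height positive
  afterwards, even one that was negative.\<close>

lemma simple_fire:
  assumes b: "b \<in> carrier W" and x: "x \<in> I" and i: "letter t = i" "i \<noteq> x"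
    and bx: "bounds (orb t) (neg (simple_root x))" and bi: "\<not> bounds (orb t) (simple_root i)"
    and hx: "0 < height b (orb t) (simple_root x)" and hi: "0 < height b (orb t) (simple_root i)"
    and hj: "\<And>j. j \<in> I - {x, i} \<Longrightarrow> 0 < height b (orb t) (simple_root j) + height b (orb t) (simple_root i)"
  shows "dih_state b (Suc t) x i (Suc 0)"
proof -
  have iI: "i \<in> I" using i letter_in by blast
  have nxt: "orb (Suc t) = s i \<otimes> orb t" using orb_cross bi i by blast
  have "m x i \<noteq> 0"
  proof
    assume "m x i = 0"
    then have "bilin (simple_root x) (simple_root i) \<le> -1" using x iI by (simp add: bilin_simple gram_def)
    then show False using bounds_dominated[OF orb_carrier bx _ iI] bi by simp
  qed
  then have m3: "3 \<le> m x i" using m_complete[of x i] x iI i by simp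
  have refl: "reflect i (simple_root x) = dih x i (Suc 0)"
    using reflect_dih[of i x 0] x iI i by (simp add: dih_0)
  have "bounds (orb (Suc t)) (neg (dih x i (Suc 0)))"
    using bounds_gen_neg[OF orb_carrier[of t] iI, of "simple_root x"] bx by (simp add: nxt refl)
  moreover have "height b (orb (Suc t)) (dih x i (Suc 0)) = height b (orb t) (simple_root x)"
    unfolding nxt refl[symmetric] using height_gen[OF b orb_carrier[of t] iI] iI by (simp add: reflect_reflect)
  moreover have "0 < height b (orb (Suc t)) (simple_root j)" if "j \<in> I" "j \<noteq> i" for j
    using height_gen_other[OF b orb_carrier[of t] iI, of j] that hi hx hj[of j]
    by (cases "j = x") (auto simp: nxt)
  moreover have "height b (orb (Suc t)) (simple_root i) < 0"
    using height_gen_self[OF b orb_carrier[of t] iI] hi by (simp add: nxt)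
  moreover have "before (Suc t) x i" using before_Suc_swap[of i x t] x i iI by auto
  ultimately show ?thesis using x iI i m3 hx by (simp add: dih_state_def)
qed

text \<open>The height of the separating root is conserved. After the crossing \<alpha>_x has
  negative height and a nonnegative coefficient, so \<alpha>_y must have positive height. Every
  third height then exceeds the old height of x, which is the sum condition in
  \<open>simple_state\<close>.\<close>

lemma dih_fire:
  assumes b: "b \<in> carrier W" and x: "x \<in> I" "y \<in> I" "x \<noteq> y" and i: "letter t = x"
    and k: "0 < k" "Suc k < m x y" and bk: "bounds (orb t) (neg (dih x y k))"
    and hx: "0 < height b (orb t) (simple_root x)"
    and hj: "\<And>j. j \<in> I - {x, y} \<Longrightarrow> 0 < height b (orb t) (simple_root j)"
    and hk: "0 < height b (orb t) (dih x y k)"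
  shows "state b (Suc t)"
proof -
  let ?h = "\<lambda>j. height b (orb t) (simple_root j)" and ?h' = "\<lambda>j. height b (orb (Suc t)) (simple_root j)"
  have nxt: "orb (Suc t) = s x \<otimes> orb t" using orb_cross dih_crosses[OF x k bk] i by blast
  have refl: "reflect x (dih x y k) = dih y x (Suc k)" using reflect_dih x by blast
  have bk': "bounds (orb (Suc t)) (neg (dih y x (Suc k)))"
    using bounds_gen_neg[OF orb_carrier[of t] x(1), of "dih x y k"] bk by (simp add: nxt refl)
  have hk': "height b (orb (Suc t)) (dih y x (Suc k)) = height b (orb t) (dih x y k)"
    unfolding nxt refl[symmetric] using height_gen[OF b orb_carrier[of t] x(1)] x by (simp add: reflect_reflect)
  have hx': "?h' x = - ?h x" using height_gen_self[OF b orb_carrier[of t] x(1)] by (simp add: nxt)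
  have hj': "?h x < ?h' j" if "j \<in> I - {x, y}" for j
    using height_gen_other[OF b orb_carrier[of t] x(1), of j] that hx hj[OF that] by (auto simp: nxt)
  have msym: "m y x = m x y" using m_sym x by simp
  have c: "1 \<le> cheb (m x y) (Suc k)" "0 \<le> cheb (m x y) (Suc (Suc k))"
    using k m_ne_1[OF x] by (auto intro!: cheb_ge_1 cheb_nonneg)
  have "0 < cheb (m x y) (Suc k) * ?h' y + cheb (m x y) (Suc (Suc k)) * ?h' x"
    using hk hk' by (simp add: dih_def height_lin_comb msym)
  moreover have "cheb (m x y) (Suc (Suc k)) * ?h' x \<le> 0"
    using c hx hx' by (intro mult_nonneg_nonpos) auto
  ultimately have "0 < cheb (m x y) (Suc k) * ?h' y" by linarith
  then have hy': "0 < ?h' y" using c by (simp add: zero_less_mult_iff)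
  have bf: "before (Suc t) y x" using before_Suc_swap x i by blast
  show ?thesis
  proof (cases "Suc (Suc k) < m x y")
    case True
    have "0 < ?h' j" if "j \<in> I - {y, x}" for j using hj'[of j] hx that by auto
    then have "dih_state b (Suc t) y x (Suc k)"
      using x bf True bk' hy' hx hx' hk hk' msym by (simp add: dih_state_def)
    then show ?thesis by (auto simp: state_def)
  next
    case False
    \<comment> \<open>Index k + 1 is the last one of the dihedral system; counted from the other end
      it is 0, and the root is simple again.\<close>
    then have mk: "m x y = Suc (Suc k)" using k by simp
    have "dih y x (Suc k) = dih x y (m y x - Suc (Suc k))"
      using x msym k by (intro dih_reverse) auto
    then have "dih y x (Suc k) = simple_root y" using x by (simp add: msym mk dih_0)
    moreover have "0 < ?h' j \<and> 0 < ?h' j + ?h' x" if "j \<in> I - {y, x}" for j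
      using hj'[of j] hx hx' that by auto
    ultimately have "simple_state b (Suc t) y x"
      using x bf bk' hy' hx hx' by (simp add: simple_state_def)
    then show ?thesis by (auto simp: state_def)
  qed
qed

text \<open>For a simple separating root, x is excluded by \<open>no_entering\<close> and y is not
  yet due, so only a third letter can cross. For a dihedral one y is not due, third letters bounce
  and x crosses.\<close>

lemma state_Suc: assumes b: "b \<in> carrier W" and "state b t" shows "state b (Suc t)"
proof -
  consider x y where "simple_state b t x y" | x y k where "dih_state b t x y k"
    using assms by (auto simp: state_def)
  then show ?thesis
  proof cases
    case 1
    then have bx: "bounds (orb t) (neg (simple_root x))" and bf: "before t x y" and xy: "x \<in> I" "y \<in> I" "x \<noteq> y"
      by (auto simp: simple_state_def)
    have lx: "letter t \<noteq> x" using no_entering[of t] bx by auto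
    have ly: "letter t \<noteq> y" using before_ne bf by blast
    show ?thesis
    proof (cases "bounds (orb t) (simple_root (letter t))")
      case True
      then have "simple_state b (Suc t) x y"
        using 1 orb_bounce[of t] before_Suc[OF bf lx] by (simp add: simple_state_def)
      then show ?thesis by (auto simp: state_def)
    next
      case False
      have st: "0 < height b (orb t) (simple_root x)"
        "\<And>j. j \<in> I - {x, y} \<Longrightarrow> 0 < height b (orb t) (simple_root j)"
        "\<And>j. j \<in> I - {x, y} \<Longrightarrow> 0 < height b (orb t) (simple_root j) + height b (orb t) (simple_root y)"
        using 1 by (auto simp: simple_state_def)
      have l: "letter t \<in> I - {x, y}" using lx ly letter_in by auto
      have "dih_state b (Suc t) x (letter t) (Suc 0)"
      proof (rule simple_fire[OF b xy(1) refl lx bx False st(1) st(2)[OF l]])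
        \<comment> \<open>The sum condition of \<open>simple_state\<close> is what handles j = y,
          the one letter of negative height; otherwise both summands are positive.\<close>
        fix j assume "j \<in> I - {x, letter t}"
        then show "0 < height b (orb t) (simple_root j) + height b (orb t) (simple_root (letter t))"
          using st(2)[of j] st(2)[OF l] st(3)[OF l] by (cases "j = y") auto
      qed
      then show ?thesis by (auto simp: state_def)
    qed
  next
    case 2
    then have st: "x \<in> I" "y \<in> I" "x \<noteq> y" "0 < k" "Suc k < m x y" "bounds (orb t) (neg (dih x y k))"
      and bf: "before t x y"
      by (auto simp: dih_state_def)
    show ?thesis
    proof (cases "letter t = x")
      case True
      show ?thesis using dih_fire[OF b st(1-3) True st(4-6)] 2 by (auto simp: dih_state_def)
    next
      case False
      have "letter t \<noteq> y" using before_ne bf by blast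
      then have "bounds (orb t) (simple_root (letter t))"
        using dih_others_bounce[OF st] False by simp
      then have "dih_state b (Suc t) x y k"
        using 2 orb_bounce[of t] before_Suc[OF bf False] by (simp add: dih_state_def)
      then show ?thesis by (auto simp: state_def)
    qed
  qed
qed

text \<open>With base point \<open>orb t\<close> all simple heights are 1 at time t, and again one
  period later. A state reached right after t would persist until then, yet it contains a negative
  simple height.\<close>

lemma no_state: "\<not> state (orb t) (Suc t)"
proof
  assume "state (orb t) (Suc t)"
  then have "state (orb t) (Suc t + k)" for k
    by (induction k) (use state_Suc[OF orb_carrier] in auto)
  then have "state (orb t) (t + period)"
    using period_pos by (metis Suc_pred add_Suc_shift)
  then have "\<exists>y\<in>I. height (orb t) (orb (t + period)) (simple_root y) < 0"
    by (auto simp: state_def simple_state_def dih_state_def)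
  then show False using height_base by (force simp: orb_periodic)
qed

lemma start_in: "start \<in> L"
proof (rule ccontr)
  assume "start \<notin> L"
  then obtain \<rho> where \<rho>: "good \<rho>" "bounds (orb 0) (neg \<rho>)"
    using ex_good_outside start by auto
  consider x where "x \<in> I" "\<rho> = simple_root x"
    | x y k where "x \<in> I" "y \<in> I" "x \<noteq> y" "0 < k" "Suc k < m x y" "\<rho> = dih x y k"
    using \<rho>(1) by (auto simp: good_def)
  then show False
  proof cases
    case 1
    then obtain p where p: "orb p = orb 0" "letter p \<noteq> x" "\<not> bounds (orb 0) (simple_root (letter p))"
      using ex_crossing[OF 1(1), of 0] \<rho>(2) by auto
    \<comment> \<open>Measured from the base point \<open>orb p\<close> all simple heights are 1, so
      the positivity hypotheses hold and the first crossing already creates a state.\<close>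
    have "dih_state (orb p) (Suc p) x (letter p) (Suc 0)"
      by (rule simple_fire) (use p 1 \<rho> start height_base[OF start] in auto)
    then show False using no_state by (auto simp: state_def)
  next
    case 2
    \<comment> \<open>Of the two names of the root, the one whose first letter is due earlier is
      chosen, since \<open>dih_fire\<close> lets that letter act.\<close>
    have "\<exists>x y k. x \<in> I \<and> y \<in> I \<and> x \<noteq> y \<and> 0 < k \<and> Suc k < m x y \<and> \<rho> = dih x y k \<and> before 0 x y"
    proof (cases "before 0 x y")
      case True
      with 2 show ?thesis by (intro exI[of _ x] exI[of _ y] exI[of _ k]) simp
    next
      case False
      then have "before 0 y x" using before_total 2 by blast
      moreover have "\<rho> = dih y x (m x y - Suc k)" using 2 dih_reverse[of x y k] by simp
      ultimately show ?thesis using 2 m_sym[of x y]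
        by (intro exI[of _ y] exI[of _ x] exI[of _ "m x y - Suc k"]) auto
    qed
    then obtain x y k where d: "x \<in> I" "y \<in> I" "x \<noteq> y" "0 < k" "Suc k < m x y" "\<rho> = dih x y k" "before 0 x y"
      by blast
    obtain p where p: "letter p = x" "\<And>q. q < p \<Longrightarrow> letter q \<noteq> x"
      using first_letter[OF d(1), of 0] by auto
    obtain p' where p': "letter p' = x" "\<And>q. q \<le> p' \<Longrightarrow> letter q \<noteq> y"
      using d(7) by (auto simp: before_def)
    have "p \<le> p'" using p p' by (metis not_le)
    \<comment> \<open>Before x is due, y does not occur either; only letters outside the pair act,
      and they bounce.\<close>
    then have "bounds (orb 0) (simple_root (letter q))" if "q < p" for q
      using that p(2)[of q] p'(2)[of q] dih_others_bounce[OF d(1-5), of 0 "letter q"] \<rho> d(6) by simp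
    then have orb: "orb p = orb 0" by (intro orb_constant) auto
    have h: "height (orb p) (orb p) (simple_root j) = 1" if "j \<in> I" for j
      using height_base that by simp
    have c: "1 \<le> cheb (m x y) k" "1 \<le> cheb (m x y) (Suc k)" using d by (auto intro!: cheb_ge_1)
    have "state (orb p) (Suc p)"
    proof (rule dih_fire[OF orb_carrier d(1-3) p(1) d(4-5)])
      show "bounds (orb p) (neg (dih x y k))" using \<rho> d orb by simp
      show "0 < height (orb p) (orb p) (dih x y k)"
        using c d h by (simp add: dih_def height_lin_comb)
    qed (use h d in auto)
    then show False using no_state by blast
  qed
qed

end

theorem theorem1p17:
  fixes W :: "('w, 'b) monoid_scheme" and I :: "'i set" and s :: "'i \<Rightarrow> 'w"
  assumes "coxeter_system W I s"
    and "coxeter_system.complete_graph W I s"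
  shows "coxeter_system.futuristic W I s"
proof -
  interpret complete_coxeter_system W I s
    using assms by (simp add: complete_coxeter_system_def complete_coxeter_system_axioms_def)
  show ?thesis
    unfolding futuristic_def heavy_def periodic_point_def
  proof (intro allI impI; elim conjE exE)
    fix L c xs u K
    assume L: "convex_subset L" "L \<noteq> {}" and xs: "index_ordering xs"
      and u: "u \<in> carrier W" "1 \<le> K" "(Pro L xs ^^ K) u = u"
    interpret complete_coxeter_convex W I s L
      by unfold_locales (rule L)+
    show "u \<in> L"
    proof (cases "I = {}")
      case True
      \<comment> \<open>Without generators the group is trivial. A round of toggles is then empty,
        and the orbit argument requires rounds of positive length.\<close>
      then have "carrier W = {\<one>\<^bsub>W\<^esub>}" using generators_generate generate_empty by simp
      then show ?thesis using L(2) L_carrier u(1) by auto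
    next
      case False
      interpret complete_coxeter_orbit W I s L xs u K
        by unfold_locales (use xs False u in auto)
      show ?thesis by (rule start_in)
    qed
  qed
qed

end
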